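(* Let $\mathfrak{g}$ be a $3$-dimensional real Lie algebra with $\dim[\mathfrak{g},\mathfrak{g}]=1$ and $[\mathfrak{g},\mathfrak{g}]\subset Z(\mathfrak{g})$ (the center), and let $w>0$ be an integer. For the weight-$w$ chain complex $C_\bullet^{[w]}$ of the Lie superalgebra $\overline{\mathfrak{g}}$ associated with $\mathfrak{g}$, one has \[ \begin{array}{c|c|c|c} m & \dim C_m^{[w]} & \dim\ker(\partial:C_m^{[w]}\to C_{m-1}^{[w]}) & m\text{-th Betti number}\\\hline w-1 & \binom{w}{2} & \binom{w}{2} & 0\\ w & 3\binom{w}{2}+\binom{w+2}{2} & 2\binom{w}{2}+\binom{w+2}{2} & w\\ w+1 & 3\binom{w}{2}+3\binom{w+2}{2} & \binom{w}{2}+2\binom{w+2}{2}+w & 3w+1\\ w+2 & \binom{w}{2}+3\binom{w+2}{2} & -\binom{w}{2}+2\binom{w+2}{2} & 3w+2\\ w+3 & \binom{w+2}{2} & w+1 & w+1 \end{array} \]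
   Context: For a finite dimensional real Lie algebra $\mathfrak{g}$ of dimension $n$, let $\overline{\mathfrak{g}}=\bigoplus_{i=0}^{n-1}\mathfrak{g}_i$ with $\mathfrak{g}_i=\Lambda^{i+1}\mathfrak{g}$ (elements of $\mathfrak{g}_i$ have grade $i$). It is a $\mathbb{Z}$-graded Lie superalgebra with the Schouten-like bracket: for $a=a_1\wedge\cdots\wedge a_k$ and $b=b_1\wedge\cdots\wedge b_l$ with $a_i,b_j\in\mathfrak{g}$, \[ [a,b]_S=\sum_{i,j}(-1)^{i+j}[a_i,b_j]\wedge a[i]\wedge b[j], \] where $a[i]$ (resp. $b[j]$) is $a$ (resp. $b$) with the factor $a_i$ (resp. $b_j$) omitted. Chains: take the quotient of the tensor algebra of the vector space $\overline{\mathfrak{g}}$ by the two-sided ideal generated by $X\otimes Y+(-1)^{xy}Y\otimes X$ for $X\in\mathfrak{g}_x$, $Y\in\mathfrak{g}_y$; denote the induced product by $\bigtriangleup$. (So factors of odd grade commute with each other, and factors of even grade anticommute with all homogeneous factors.) The space $C_m$ of $m$-chains is the image of the $m$-fold tensors. The weight of $Y_1\bigtriangleup\cdots\bigtriangleup Y_m$ with $Y_i\in\mathfrak{g}_{y_i}$ is $y_1+\cdots+y_m$, and $C_m^{[w]}\subset C_m$ is the subspace of chains of weight $w$. The boundary operator $\partial:C_m\to C_{m-1}$ is \[ \partial(Y_1\bigtriangleup\cdots\bigtriangleup Y_m)=\sum_{i<j}(-1)^{\,i-1+y_i\sum_{i<s<j}y_s}\;Y_1\bigtriangleup\cdots\widehat{Y_i}\cdots\bigtriangleup[Y_i,Y_j]_S\bigtriangleup\cdots\bigtriangleup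 Y_m, \] where $Y_i$ is omitted and $[Y_i,Y_j]_S$ is placed in the position of $Y_j$. It preserves weight and satisfies $\partial\circ\partial=0$. The $m$-th Betti number in weight $w$ is $\dim\bigl(\ker(\partial:C_m^{[w]}\to C_{m-1}^{[w]})/\partial(C_{m+1}^{[w]})\bigr)$. By convention $\binom{1}{2}=0$. *)

theory Defs
  imports "HOL-Analysis.Analysis" "HOL-Analysis.Finite_Function_Topology"
begin

section \<open>Quotients of real algebras by two-sided ideals\<close>

text \<open>Unital algebras have sort \<open>{real_algebra, monoid_mult}\<close> here: the class \<open>real_algebra_1\<close> would in
  addition require \<open>0 \<noteq> 1\<close>, which is not a formal consequence of taking quotients.\<close>

definition two_sided_ideal :: "'b::{real_algebra, monoid_mult} set \<Rightarrow> 'b set" where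
  "two_sided_ideal S = span {a * s * b | a s b. s \<in> S}"

lemma two_sided_ideal_zero: "0 \<in> two_sided_ideal S"
  unfolding two_sided_ideal_def by (rule span_zero)

lemma two_sided_ideal_refl: "p = q \<Longrightarrow> p - q \<in> two_sided_ideal S"
  by (simp add: two_sided_ideal_zero)

lemma two_sided_ideal_mult_left:
  assumes "x \<in> two_sided_ideal S"
  shows "c * x \<in> two_sided_ideal S"
  using assms unfolding two_sided_ideal_def
proof (induction rule: span_induct_alt)
  case base
  show ?case by (simp add: span_zero)
next
  case (step r x y)
  then obtain a s b where x: "x = a * s * b" "s \<in> S" by blast
  have "(c * a) * s * b \<in> span {a * s * b | a s b. s \<in> S}"
    using x(2) by (intro span_base) blast
  then show ?case
    using step.IH x(1) by (simp add: distrib_left mult.assoc span_add span_scale)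
qed

lemma two_sided_ideal_mult_right:
  assumes "x \<in> two_sided_ideal S"
  shows "x * c \<in> two_sided_ideal S"
  using assms unfolding two_sided_ideal_def
proof (induction rule: span_induct_alt)
  case base
  show ?case by (simp add: span_zero)
next
  case (step r x y)
  then obtain a s b where x: "x = a * s * b" "s \<in> S" by blast
  have "a * s * (b * c) \<in> span {a * s * b | a s b. s \<in> S}"
    using x(2) by (intro span_base) blast
  then show ?case
    using step.IH x(1) by (simp add: distrib_right mult.assoc span_add span_scale)
qed

lemma equivp_two_sided_ideal: "equivp (\<lambda>p q. p - q \<in> two_sided_ideal S)"
proof (rule equivpI)
  show "reflp (\<lambda>p q. p - q \<in> two_sided_ideal S)"
    by (rule reflpI) (simp add: two_sided_ideal_zero)
  show "symp (\<lambda>p q. p - q \<in> two_sided_ideal S)"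
  proof (rule sympI)
    fix p q assume "p - q \<in> two_sided_ideal S"
    then have "- (p - q) \<in> two_sided_ideal S"
      unfolding two_sided_ideal_def by (rule span_neg)
    then show "q - p \<in> two_sided_ideal S" by simp
  qed
  show "transp (\<lambda>p q. p - q \<in> two_sided_ideal S)"
  proof (rule transpI)
    fix p q r assume "p - q \<in> two_sided_ideal S" "q - r \<in> two_sided_ideal S"
    then have "(p - q) + (q - r) \<in> two_sided_ideal S"
      unfolding two_sided_ideal_def by (rule span_add)
    then show "p - r \<in> two_sided_ideal S" by simp
  qed
qed

lemma two_sided_ideal_cong_add:
  assumes "p - p' \<in> two_sided_ideal S" "q - q' \<in> two_sided_ideal S"
  shows "(p + q) - (p' + q') \<in> two_sided_ideal S"
proof -
  have "(p - p') + (q - q') \<in> two_sided_ideal S"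
    using assms unfolding two_sided_ideal_def by (rule span_add)
  then show ?thesis by (simp add: algebra_simps)
qed

lemma two_sided_ideal_cong_minus:
  assumes "p - p' \<in> two_sided_ideal S"
  shows "- p - - p' \<in> two_sided_ideal S"
proof -
  have "- (p - p') \<in> two_sided_ideal S"
    using assms unfolding two_sided_ideal_def by (rule span_neg)
  then show ?thesis by simp
qed

lemma two_sided_ideal_cong_diff:
  assumes "p - p' \<in> two_sided_ideal S" "q - q' \<in> two_sided_ideal S"
  shows "(p - q) - (p' - q') \<in> two_sided_ideal S"
proof -
  have "(p - p') - (q - q') \<in> two_sided_ideal S"
    using assms unfolding two_sided_ideal_def by (rule span_diff)
  then show ?thesis by (simp add: algebra_simps)
qed

lemma two_sided_ideal_cong_mult:
  assumes "p - p' \<in> two_sided_ideal S" "q - q' \<in> two_sided_ideal S"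
  shows "p * q - p' * q' \<in> two_sided_ideal S"
proof -
  have "p * q - p' * q' = (p - p') * q + p' * (q - q')"
    by (simp add: algebra_simps)
  then show ?thesis
    using two_sided_ideal_mult_right[OF assms(1)] two_sided_ideal_mult_left[OF assms(2)]
    unfolding two_sided_ideal_def by (simp add: span_add)
qed

lemma two_sided_ideal_cong_scaleR:
  assumes "p - p' \<in> two_sided_ideal S"
  shows "c *\<^sub>R p - c *\<^sub>R p' \<in> two_sided_ideal S"
proof -
  have "c *\<^sub>R (p - p') \<in> two_sided_ideal S"
    using assms unfolding two_sided_ideal_def by (rule span_scale)
  then show ?thesis by (simp add: scaleR_diff_right)
qed


section \<open>The tensor algebra of a real vector space\<close>

text \<open>The free monoid, written additively so that the finitely supported real functions on it
  form the free associative algebra with the convolution product of \<^theory>\<open>HOL-Library.Poly_Mapping\<close>.\<close>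

datatype 'a word = Word "'a list"

instantiation word :: (type) monoid_add
begin

definition zero_word :: "'a word" where "zero_word = Word []"

fun plus_word :: "'a word \<Rightarrow> 'a word \<Rightarrow> 'a word" where
  "plus_word (Word u) (Word v) = Word (u @ v)"

instance
proof
  fix a b c :: "'a word"
  show "a + b + c = a + (b + c)" by (cases a; cases b; cases c) simp
  show "0 + a = a" by (cases a) (simp add: zero_word_def)
  show "a + 0 = a" by (cases a) (simp add: zero_word_def)
qed

end

lemma lookup_scaleR:
  "Poly_Mapping.lookup (r *\<^sub>R p) k = r *\<^sub>R Poly_Mapping.lookup p k"
proof -
  have "finite {k. r *\<^sub>R Poly_Mapping.lookup p k \<noteq> 0}"
    by (rule finite_subset[OF _ finite_keys[of p]]) (auto simp: in_keys_iff)
  then show ?thesis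
    by (simp add: scaleR_poly_mapping_def Abs_poly_mapping_inverse)
qed

instance poly_mapping :: (monoid_add, real_algebra_1) real_algebra_1
proof
  fix r :: real and x y :: "'a \<Rightarrow>\<^sub>0 'b"
  have sum_scale: "Sum_any (\<lambda>a. r *\<^sub>R g a) = r *\<^sub>R Sum_any g"
    if "finite {a. g a \<noteq> 0}" for g :: "'a \<Rightarrow> 'b"
  proof -
    have "Sum_any (\<lambda>a. r *\<^sub>R g a) = (\<Sum>a | g a \<noteq> 0. r *\<^sub>R g a)"
      by (rule Sum_any.expand_superset) (use that in auto)
    then show ?thesis
      by (simp add: Sum_any.expand_set scaleR_sum_right)
  qed
  have when_scale: "(r *\<^sub>R z when P) = r *\<^sub>R (z when P)" for z :: 'b and P
    by (simp add: when_def)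
  have fin: "finite {q. (Poly_Mapping.lookup y q when k = l + q) \<noteq> 0}" for k l
    by (rule finite_subset[OF _ finite_keys[of y]]) (auto simp: in_keys_iff)
  have fin': "finite {l. Poly_Mapping.lookup x l * Sum_any (\<lambda>q. Poly_Mapping.lookup y q when k = l + q) \<noteq> 0}" for k
    by (rule finite_subset[OF _ finite_keys[of x]]) (auto simp: in_keys_iff)
  show "r *\<^sub>R x * y = r *\<^sub>R (x * y)"
    by (rule poly_mapping_eqI)
      (simp add: times_poly_mapping.rep_eq prod_fun_def lookup_scaleR sum_scale fin')
  show "x * r *\<^sub>R y = r *\<^sub>R (x * y)"
    by (rule poly_mapping_eqI)
      (simp add: times_poly_mapping.rep_eq prod_fun_def lookup_scaleR when_scale sum_scale fin fin')
qed

definition letter :: "'a \<Rightarrow> ('a word \<Rightarrow>\<^sub>0 real)" where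
  "letter x = Poly_Mapping.single (Word [x]) 1"

text \<open>The tensor algebra is the free associative algebra on the \<^emph>\<open>set\<close> of all vectors, modulo
  the relations that make the generators depend linearly on the vector.\<close>

definition linear_relations :: "('a::real_vector word \<Rightarrow>\<^sub>0 real) set" where
  "linear_relations =
     {letter (x + y) - letter x - letter y | x y. True} \<union>
     {letter (c *\<^sub>R x) - c *\<^sub>R letter x | c x. True}"

quotient_type (overloaded) 'a tensor =
  "'a::real_vector word \<Rightarrow>\<^sub>0 real" / "\<lambda>p q. p - q \<in> two_sided_ideal linear_relations"
  by (rule equivp_two_sided_ideal)

instantiation tensor :: (real_vector) "{real_algebra, monoid_mult}"
begin

lift_definition zero_tensor :: "'a tensor" is 0 .
lift_definition one_tensor :: "'a tensor" is 1 .
lift_definition plus_tensor :: "'a tensor \<Rightarrow> 'a tensor \<Rightarrow> 'a tensor" is "(+)"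
  by (rule two_sided_ideal_cong_add)
lift_definition minus_tensor :: "'a tensor \<Rightarrow> 'a tensor \<Rightarrow> 'a tensor" is "(-)"
  by (rule two_sided_ideal_cong_diff)
lift_definition uminus_tensor :: "'a tensor \<Rightarrow> 'a tensor" is uminus
  by (rule two_sided_ideal_cong_minus)
lift_definition times_tensor :: "'a tensor \<Rightarrow> 'a tensor \<Rightarrow> 'a tensor" is "(*)"
  by (rule two_sided_ideal_cong_mult)
lift_definition scaleR_tensor :: "real \<Rightarrow> 'a tensor \<Rightarrow> 'a tensor" is scaleR
  by (rule two_sided_ideal_cong_scaleR)

instance
proof
  fix a b c :: "'a tensor" and r s :: real
  show "a + b + c = a + (b + c)"
    by (transfer, rule two_sided_ideal_refl, rule add.assoc)
  show "a + b = b + a"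
    by (transfer, rule two_sided_ideal_refl, rule add.commute)
  show "0 + a = a"
    by (transfer, rule two_sided_ideal_refl, rule add_0)
  show "- a + a = 0"
    by (transfer, rule two_sided_ideal_refl, rule left_minus)
  show "a - b = a + - b"
    by (transfer, rule two_sided_ideal_refl, rule diff_conv_add_uminus)
  show "r *\<^sub>R (a + b) = r *\<^sub>R a + r *\<^sub>R b"
    by (transfer, rule two_sided_ideal_refl, rule scaleR_add_right)
  show "(r + s) *\<^sub>R a = r *\<^sub>R a + s *\<^sub>R a"
    by (transfer, rule two_sided_ideal_refl, rule scaleR_add_left)
  show "r *\<^sub>R s *\<^sub>R a = (r * s) *\<^sub>R a"
    by (transfer, rule two_sided_ideal_refl, rule scaleR_scaleR)
  show "1 *\<^sub>R a = a"
    by (transfer, rule two_sided_ideal_refl, rule scaleR_one)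
  show "a * b * c = a * (b * c)"
    by (transfer, rule two_sided_ideal_refl, rule mult.assoc)
  show "(a + b) * c = a * c + b * c"
    by (transfer, rule two_sided_ideal_refl, rule distrib_right)
  show "a * (b + c) = a * b + a * c"
    by (transfer, rule two_sided_ideal_refl, rule distrib_left)
  show "1 * a = a"
    by (transfer, rule two_sided_ideal_refl, rule mult_1_left)
  show "a * 1 = a"
    by (transfer, rule two_sided_ideal_refl, rule mult_1_right)
  show "r *\<^sub>R a * b = r *\<^sub>R (a * b)"
    by (transfer, rule two_sided_ideal_refl, rule mult_scaleR_left)
  show "a * r *\<^sub>R b = r *\<^sub>R (a * b)"
    by (transfer, rule two_sided_ideal_refl, rule mult_scaleR_right)
qed

end

lift_definition tensor_of :: "'a::real_vector \<Rightarrow> 'a tensor" is letter .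


section \<open>The exterior algebra and the graded space of its positive-degree part\<close>

definition square_relations :: "'a::real_vector tensor set" where
  "square_relations = {tensor_of x * tensor_of x | x. True}"

quotient_type (overloaded) 'a exterior =
  "'a::real_vector tensor" / "\<lambda>p q. p - q \<in> two_sided_ideal square_relations"
  by (rule equivp_two_sided_ideal)

instantiation exterior :: (real_vector) "{real_algebra, monoid_mult}"
begin

lift_definition zero_exterior :: "'a exterior" is 0 .
lift_definition one_exterior :: "'a exterior" is 1 .
lift_definition plus_exterior :: "'a exterior \<Rightarrow> 'a exterior \<Rightarrow> 'a exterior" is "(+)"
  by (rule two_sided_ideal_cong_add)
lift_definition minus_exterior :: "'a exterior \<Rightarrow> 'a exterior \<Rightarrow> 'a exterior" is "(-)"
  by (rule two_sided_ideal_cong_diff)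
lift_definition uminus_exterior :: "'a exterior \<Rightarrow> 'a exterior" is uminus
  by (rule two_sided_ideal_cong_minus)
lift_definition times_exterior :: "'a exterior \<Rightarrow> 'a exterior \<Rightarrow> 'a exterior" is "(*)"
  by (rule two_sided_ideal_cong_mult)
lift_definition scaleR_exterior :: "real \<Rightarrow> 'a exterior \<Rightarrow> 'a exterior" is scaleR
  by (rule two_sided_ideal_cong_scaleR)

instance
proof
  fix a b c :: "'a exterior" and r s :: real
  show "a + b + c = a + (b + c)"
    by (transfer, rule two_sided_ideal_refl, rule add.assoc)
  show "a + b = b + a"
    by (transfer, rule two_sided_ideal_refl, rule add.commute)
  show "0 + a = a"
    by (transfer, rule two_sided_ideal_refl, rule add_0)
  show "- a + a = 0"
    by (transfer, rule two_sided_ideal_refl, rule left_minus)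
  show "a - b = a + - b"
    by (transfer, rule two_sided_ideal_refl, rule diff_conv_add_uminus)
  show "r *\<^sub>R (a + b) = r *\<^sub>R a + r *\<^sub>R b"
    by (transfer, rule two_sided_ideal_refl, rule scaleR_add_right)
  show "(r + s) *\<^sub>R a = r *\<^sub>R a + s *\<^sub>R a"
    by (transfer, rule two_sided_ideal_refl, rule scaleR_add_left)
  show "r *\<^sub>R s *\<^sub>R a = (r * s) *\<^sub>R a"
    by (transfer, rule two_sided_ideal_refl, rule scaleR_scaleR)
  show "1 *\<^sub>R a = a"
    by (transfer, rule two_sided_ideal_refl, rule scaleR_one)
  show "a * b * c = a * (b * c)"
    by (transfer, rule two_sided_ideal_refl, rule mult.assoc)
  show "(a + b) * c = a * c + b * c"
    by (transfer, rule two_sided_ideal_refl, rule distrib_right)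
  show "a * (b + c) = a * b + a * c"
    by (transfer, rule two_sided_ideal_refl, rule distrib_left)
  show "1 * a = a"
    by (transfer, rule two_sided_ideal_refl, rule mult_1_left)
  show "a * 1 = a"
    by (transfer, rule two_sided_ideal_refl, rule mult_1_right)
  show "r *\<^sub>R a * b = r *\<^sub>R (a * b)"
    by (transfer, rule two_sided_ideal_refl, rule mult_scaleR_left)
  show "a * r *\<^sub>R b = r *\<^sub>R (a * b)"
    by (transfer, rule two_sided_ideal_refl, rule mult_scaleR_right)
qed

end

lift_definition exterior_of :: "'a::real_vector \<Rightarrow> 'a exterior" is tensor_of .

definition wedge :: "'a::real_vector list \<Rightarrow> 'a exterior" where
  "wedge as = prod_list (map exterior_of as)"

text \<open>The direct sum of the \<open>\<Lambda>\<^sup>k\<close> for \<open>k \<ge> 1\<close>; on a space of dimension \<open>n\<close> those with \<open>k > n\<close> vanish.\<close>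

typedef (overloaded) 'a superspace =
  "span {wedge as | as. as \<noteq> []} :: 'a::real_vector exterior set"
  by (rule exI[of _ 0]) (rule span_zero)

setup_lifting type_definition_superspace

instantiation superspace :: (real_vector) real_vector
begin

lift_definition zero_superspace :: "'a superspace" is 0 by (rule span_zero)
lift_definition plus_superspace :: "'a superspace \<Rightarrow> 'a superspace \<Rightarrow> 'a superspace" is "(+)"
  by (rule span_add)
lift_definition minus_superspace :: "'a superspace \<Rightarrow> 'a superspace \<Rightarrow> 'a superspace" is "(-)"
  by (rule span_diff)
lift_definition uminus_superspace :: "'a superspace \<Rightarrow> 'a superspace" is uminus
  by (rule span_neg)
lift_definition scaleR_superspace :: "real \<Rightarrow> 'a superspace \<Rightarrow> 'a superspace" is scaleR
  by (rule span_scale)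

instance
proof
  fix a b c :: "'a superspace" and r s :: real
  show "a + b + c = a + (b + c)"
    by (transfer, rule add.assoc)
  show "a + b = b + a"
    by (transfer, rule add.commute)
  show "0 + a = a"
    by (transfer, rule add_0)
  show "- a + a = 0"
    by (transfer, rule left_minus)
  show "a - b = a + - b"
    by (transfer, rule diff_conv_add_uminus)
  show "r *\<^sub>R (a + b) = r *\<^sub>R a + r *\<^sub>R b"
    by (transfer, rule scaleR_add_right)
  show "(r + s) *\<^sub>R a = r *\<^sub>R a + s *\<^sub>R a"
    by (transfer, rule scaleR_add_left)
  show "r *\<^sub>R s *\<^sub>R a = (r * s) *\<^sub>R a"
    by (transfer, rule scaleR_scaleR)
  show "1 *\<^sub>R a = a"
    by (transfer, rule scaleR_one)
qed

end

text \<open>Only meaningful for nonempty lists.\<close>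

definition swedge :: "'a::real_vector list \<Rightarrow> 'a superspace" where
  "swedge as = Abs_superspace (wedge as)"

lemma Rep_swedge: "as \<noteq> [] \<Longrightarrow> Rep_superspace (swedge as) = wedge as"
  unfolding swedge_def by (rule Abs_superspace_inverse) (rule span_base, auto)

definition grade :: "nat \<Rightarrow> 'a::real_vector superspace set" where
  "grade i = span {swedge as | as. length as = i + 1}"


section \<open>Lie algebras and the Schouten bracket\<close>

definition lie_bracket :: "('a::real_vector \<Rightarrow> 'a \<Rightarrow> 'a) \<Rightarrow> bool" where
  "lie_bracket br \<longleftrightarrow> bilinear br \<and> (\<forall>x. br x x = 0) \<and>
     (\<forall>x y z. br x (br y z) + br y (br z x) + br z (br x y) = 0)"

definition derived_algebra :: "('a::real_vector \<Rightarrow> 'a \<Rightarrow> 'a) \<Rightarrow> 'a set" where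
  "derived_algebra br = span {br x y | x y. True}"

definition lie_center :: "('a::real_vector \<Rightarrow> 'a \<Rightarrow> 'a) \<Rightarrow> 'a set" where
  "lie_center br = {z. \<forall>x. br z x = 0}"

definition omit :: "nat \<Rightarrow> 'b list \<Rightarrow> 'b list" where
  "omit i xs = take i xs @ drop (Suc i) xs"

text \<open>The bilinear map given by the formula on decomposable elements, unique because these
  span. Indices count from 0, which leaves the parity of \<open>i + j\<close> unchanged.\<close>

definition schouten ::
  "('a::real_vector \<Rightarrow> 'a \<Rightarrow> 'a) \<Rightarrow> 'a superspace \<Rightarrow> 'a superspace \<Rightarrow> 'a superspace" where
  "schouten br = (THE B. bilinear B \<and>
     (\<forall>as bs. as \<noteq> [] \<longrightarrow> bs \<noteq> [] \<longrightarrow>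
        B (swedge as) (swedge bs) =
          (\<Sum>i<length as. \<Sum>j<length bs.
             (-1) ^ (i + j) *\<^sub>R swedge (br (as ! i) (bs ! j) # omit i as @ omit j bs))))"


section \<open>Chains, weights and the boundary operator\<close>

definition supersymmetry_relations :: "'a::real_vector superspace tensor set" where
  "supersymmetry_relations =
     {tensor_of X * tensor_of Y + (-1) ^ (x * y) *\<^sub>R (tensor_of Y * tensor_of X) | X Y x y.
        X \<in> grade x \<and> Y \<in> grade y}"

quotient_type (overloaded) 'a chain =
  "'a::real_vector superspace tensor" / "\<lambda>p q. p - q \<in> two_sided_ideal supersymmetry_relations"
  by (rule equivp_two_sided_ideal)

instantiation chain :: (real_vector) "{real_algebra, monoid_mult}"
begin

lift_definition zero_chain :: "'a chain" is 0 .
lift_definition one_chain :: "'a chain" is 1 .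
lift_definition plus_chain :: "'a chain \<Rightarrow> 'a chain \<Rightarrow> 'a chain" is "(+)"
  by (rule two_sided_ideal_cong_add)
lift_definition minus_chain :: "'a chain \<Rightarrow> 'a chain \<Rightarrow> 'a chain" is "(-)"
  by (rule two_sided_ideal_cong_diff)
lift_definition uminus_chain :: "'a chain \<Rightarrow> 'a chain" is uminus
  by (rule two_sided_ideal_cong_minus)
lift_definition times_chain :: "'a chain \<Rightarrow> 'a chain \<Rightarrow> 'a chain" is "(*)"
  by (rule two_sided_ideal_cong_mult)
lift_definition scaleR_chain :: "real \<Rightarrow> 'a chain \<Rightarrow> 'a chain" is scaleR
  by (rule two_sided_ideal_cong_scaleR)

instance
proof
  fix a b c :: "'a chain" and r s :: real
  show "a + b + c = a + (b + c)"
    by (transfer, rule two_sided_ideal_refl, rule add.assoc)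
  show "a + b = b + a"
    by (transfer, rule two_sided_ideal_refl, rule add.commute)
  show "0 + a = a"
    by (transfer, rule two_sided_ideal_refl, rule add_0)
  show "- a + a = 0"
    by (transfer, rule two_sided_ideal_refl, rule left_minus)
  show "a - b = a + - b"
    by (transfer, rule two_sided_ideal_refl, rule diff_conv_add_uminus)
  show "r *\<^sub>R (a + b) = r *\<^sub>R a + r *\<^sub>R b"
    by (transfer, rule two_sided_ideal_refl, rule scaleR_add_right)
  show "(r + s) *\<^sub>R a = r *\<^sub>R a + s *\<^sub>R a"
    by (transfer, rule two_sided_ideal_refl, rule scaleR_add_left)
  show "r *\<^sub>R s *\<^sub>R a = (r * s) *\<^sub>R a"
    by (transfer, rule two_sided_ideal_refl, rule scaleR_scaleR)
  show "1 *\<^sub>R a = a"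
    by (transfer, rule two_sided_ideal_refl, rule scaleR_one)
  show "a * b * c = a * (b * c)"
    by (transfer, rule two_sided_ideal_refl, rule mult.assoc)
  show "(a + b) * c = a * c + b * c"
    by (transfer, rule two_sided_ideal_refl, rule distrib_right)
  show "a * (b + c) = a * b + a * c"
    by (transfer, rule two_sided_ideal_refl, rule distrib_left)
  show "1 * a = a"
    by (transfer, rule two_sided_ideal_refl, rule mult_1_left)
  show "a * 1 = a"
    by (transfer, rule two_sided_ideal_refl, rule mult_1_right)
  show "r *\<^sub>R a * b = r *\<^sub>R (a * b)"
    by (transfer, rule two_sided_ideal_refl, rule mult_scaleR_left)
  show "a * r *\<^sub>R b = r *\<^sub>R (a * b)"
    by (transfer, rule two_sided_ideal_refl, rule mult_scaleR_right)
qed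

end

definition chain_of :: "'a::real_vector superspace \<Rightarrow> 'a chain" where
  "chain_of X = abs_chain (tensor_of X)"

definition chain_prod :: "'a::real_vector superspace list \<Rightarrow> 'a chain" where
  "chain_prod Ys = prod_list (map chain_of Ys)"

definition chains :: "nat \<Rightarrow> 'a::real_vector chain set" where
  "chains m = span {chain_prod Ys | Ys. length Ys = m}"

text \<open>\<open>homogeneous Ys ys\<close>: the \<open>i\<close>-th factor lies in the component of grade \<open>ys ! i\<close>.\<close>

definition homogeneous :: "'a::real_vector superspace list \<Rightarrow> nat list \<Rightarrow> bool" where
  "homogeneous Ys ys \<longleftrightarrow> list_all2 (\<lambda>Y y. Y \<in> grade y) Ys ys"

definition weight_chains :: "nat \<Rightarrow> nat \<Rightarrow> 'a::real_vector chain set" where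
  "weight_chains m w =
     span {chain_prod Ys | Ys ys. homogeneous Ys ys \<and> length Ys = m \<and> sum_list ys = w}"

text \<open>The linear map given by the formula on products of homogeneous elements, unique because
  these span. With indices from 0 the exponent \<open>i - 1\<close> becomes \<open>i\<close>. The bracket first
  overwrites the factor in position \<open>j\<close>, then the factor in position \<open>i < j\<close> is removed.\<close>

definition boundary :: "('a::real_vector \<Rightarrow> 'a \<Rightarrow> 'a) \<Rightarrow> 'a chain \<Rightarrow> 'a chain" where
  "boundary br = (THE D. linear D \<and>
     (\<forall>Ys ys. homogeneous Ys ys \<longrightarrow>
        D (chain_prod Ys) =
          (\<Sum>(i, j) \<in> {(i, j). i < j \<and> j < length Ys}.
             (-1) ^ (i + ys ! i * (\<Sum>s \<in> {i<..<j}. ys ! s)) *\<^sub>R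
               chain_prod (omit i (Ys[j := schouten br (Ys ! i) (Ys ! j)])))))"


section \<open>Homology\<close>

text \<open>The cosets of the elements of \<open>B\<close> are distinct and form a basis of \<open>U/W\<close>.\<close>

definition quotient_basis :: "'b::real_vector set \<Rightarrow> 'b set \<Rightarrow> 'b set \<Rightarrow> bool" where
  "quotient_basis U W B \<longleftrightarrow> B \<subseteq> U \<and>
     (\<forall>F c. finite F \<longrightarrow> F \<subseteq> B \<longrightarrow> (\<Sum>b\<in>F. c b *\<^sub>R b) \<in> W \<longrightarrow> (\<forall>b\<in>F. c b = 0)) \<and>
     (\<forall>u\<in>U. \<exists>v \<in> span B. u - v \<in> W)"

definition quotient_dim :: "'b::real_vector set \<Rightarrow> 'b set \<Rightarrow> nat" where
  "quotient_dim U W = card (SOME B. quotient_basis U W B)"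

definition weight_cycles :: "('a::real_vector \<Rightarrow> 'a \<Rightarrow> 'a) \<Rightarrow> nat \<Rightarrow> nat \<Rightarrow> 'a chain set" where
  "weight_cycles br m w = {c \<in> weight_chains m w. boundary br c = 0}"

definition betti :: "('a::real_vector \<Rightarrow> 'a \<Rightarrow> 'a) \<Rightarrow> nat \<Rightarrow> nat \<Rightarrow> nat" where
  "betti br m w =
     quotient_dim (weight_cycles br m w) (boundary br ` weight_chains (m + 1) w)"

end

theory Submission
  imports Defs
begin

text \<open>
  By hypothesis the Lie algebra is the Heisenberg algebra: it has a basis \<open>Z1, Z2, Z3\<close> whose only
  nonzero bracket is \<open>[Z1, Z2] = Z3\<close> (\<open>heisenberg_basis_exists\<close>). The superspace then has the basis
  \<open>Z1, Z2, Z3\<close> of grade 0, \<open>U1 = Z2 \<and> Z3\<close>, \<open>U2 = Z1 \<and> Z3\<close>, \<open>U3 = Z1 \<and> Z2\<close> of grade 1 and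
  \<open>V = Z1 \<and> Z2 \<and> Z3\<close> of grade 2, and the Schouten bracket is given by \<open>[Z1, Z2] = Z3\<close>, \<open>[Z1, U3] = U2\<close>,
  \<open>[Z2, U3] = U1\<close> and \<open>[U3, U3] = 2 V\<close> (\<open>schouten_eq\<close>). The chain algebra is
  the free supercommutative algebra on these seven elements: exterior in \<open>Z1, Z2, Z3, V\<close>, polynomial
  in \<open>U1, U2, U3\<close>.

  The algebras are quotients of free algebras by ideals, so the work lies in showing that the
  expected monomials remain independent. Linear maps out of such a quotient are
  multilinear functions of words that respect the relations (\<open>linear_factor_exterior\<close>,
  \<open>linear_factor_chain\<close>). Minors of coordinates give the functionals that separate the wedge
  products. For chains, the formal left multiplications by generators on the vector space over the
  ordered monomials satisfy the relations, and yield mutually inverse maps \<open>\<Phi>\<close> and \<open>\<Psi>\<close> between chains and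
  combinations of monomials.

  On monomials the boundary is a differential operator with four summands, one for each of the
  brackets above. It satisfies \<open>\<partial> (g x) = ad g x - g (\<partial> x)\<close> with a superderivation \<open>ad g\<close>
  (\<open>bd_lmul\<close>, \<open>ad_lmul\<close>), and this recursion unfolds to the defining formula of the boundary on
  products of homogeneous elements (\<open>bdry_chain_prod\<close>, \<open>boundary_eq\<close>).

  It remains to count. A monomial of length \<open>m\<close> and weight \<open>w\<close> has \<open>m - w\<close> more factors \<open>Z\<close> than factors \<open>V\<close>,
  which gives the dimensions of the spaces of chains. In each of the five lengths the equations
  between coefficients of a cycle can be solved successively. The coefficients that stay free are those of an explicit set of monomials, whose
  cardinality is the dimension of the space of cycles. By the rank-nullity theorem the Betti number in
  length \<open>m\<close> is the dimension of the \<open>m\<close>-cycles plus that of the \<open>(m + 1)\<close>-cycles minus that of the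
  \<open>(m + 1)\<close>-chains (\<open>betti_eq\<close>).
\<close>

section \<open>Linear algebra in real vector spaces\<close>

lemma finite_if_independent_if_finite_span:
  fixes B :: "'b::real_vector set"
  assumes "independent B" "B \<subseteq> span F" "finite F"
  shows "finite B"
  using independent_span_bound[OF assms(3,1,2)] by simp

text \<open>A combination of \<open>B\<close> that lies in \<open>W\<close> is also one of \<open>C\<close>, so independence of the union kills both.\<close>

lemma quotient_basis_if_complement:
  fixes U W :: "'b::real_vector set"
  assumes U: "subspace U" and W: "subspace W" "W \<subseteq> U"
    and C: "independent C" "span C = W" and disj: "B \<inter> C = {}"
    and BU: "B \<subseteq> U" "independent (B \<union> C)" "U \<subseteq> span (B \<union> C)"
  shows "quotient_basis U W B"
  unfolding quotient_basis_def
proof (intro conjI allI impI ballI)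
  show "B \<subseteq> U" by fact
next
  fix F c b assume F: "finite F" "F \<subseteq> B" "(\<Sum>b\<in>F. c b *\<^sub>R b) \<in> W" "b \<in> F"
  then have "(\<Sum>b\<in>F. c b *\<^sub>R b) \<in> span C" using C by simp
  then obtain t r where t: "finite t" "t \<subseteq> C" "(\<Sum>b\<in>F. c b *\<^sub>R b) = (\<Sum>a\<in>t. r a *\<^sub>R a)"
    unfolding span_explicit by blast
  define u where "u v = (if v \<in> F then c v else - r v)" for v
  have d: "F \<inter> t = {}" using F(2) t(2) disj by blast
  have "(\<Sum>v\<in>F \<union> t. u v *\<^sub>R v) = (\<Sum>v\<in>F. u v *\<^sub>R v) + (\<Sum>v\<in>t. u v *\<^sub>R v)"
    by (rule sum.union_disjoint) (use F t d in auto)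
  also have "(\<Sum>v\<in>F. u v *\<^sub>R v) = (\<Sum>b\<in>F. c b *\<^sub>R b)"
    by (rule sum.cong) (auto simp: u_def)
  also have "(\<Sum>v\<in>t. u v *\<^sub>R v) = (\<Sum>v\<in>t. - (r v *\<^sub>R v))"
    by (rule sum.cong) (use d in \<open>auto simp: u_def\<close>)
  also have "\<dots> = - (\<Sum>a\<in>t. r a *\<^sub>R a)" by (rule sum_negf)
  finally have "(\<Sum>v\<in>F \<union> t. u v *\<^sub>R v) = 0" using t by simp
  then have "u b = 0"
    using BU(2) F t unfolding independent_explicit_finite_subsets
    by (meson UnI1 finite_UnI Un_mono)
  then show "c b = 0" using F by (simp add: u_def)
next
  fix u assume "u \<in> U"
  then have "u \<in> span (B \<union> C)" using BU by blast
  then obtain x y where xy: "u = x + y" "x \<in> span B" "y \<in> span C"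
    unfolding span_Un by blast
  then show "\<exists>v\<in>span B. u - v \<in> W" using C by (intro bexI[of _ x]) auto
qed

text \<open>Conversely every basis of \<open>U/W\<close> together with a basis of \<open>W\<close> is a basis of \<open>U\<close>. This makes the
  cardinality independent of the basis that \<^const>\<open>quotient_dim\<close> chooses.\<close>

lemma card_quotient_basis:
  fixes U W :: "'b::real_vector set"
  assumes U: "subspace U" "U \<subseteq> span G" "finite G" and W: "subspace W" "W \<subseteq> U"
    and B: "quotient_basis U W B"
  shows "card B = dim U - dim W" "dim W \<le> dim U" "independent B" "finite B"
proof -
  obtain C where C: "C \<subseteq> W" "independent C" "W \<subseteq> span C" "card C = dim W"
    using basis_exists by blast
  have spC: "span C = W" using C W by (metis span_subspace)
  have finC: "finite C"
    using finite_if_independent_if_finite_span[OF C(2) _ U(3)] C(1) W U by blast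
  have BU: "B \<subseteq> U"
    and Bi: "\<And>F c. finite F \<Longrightarrow> F \<subseteq> B \<Longrightarrow> (\<Sum>b\<in>F. c b *\<^sub>R b) \<in> W \<Longrightarrow> \<forall>b\<in>F. c b = 0"
    and Bs: "\<And>u. u \<in> U \<Longrightarrow> \<exists>v\<in>span B. u - v \<in> W"
    using B unfolding quotient_basis_def by blast+
  have disj: "B \<inter> C = {}"
  proof (rule ccontr)
    assume "B \<inter> C \<noteq> {}"
    then obtain b where b: "b \<in> B" "b \<in> C" by blast
    then have "(\<Sum>b\<in>{b}. (\<lambda>_. 1) b *\<^sub>R b) \<in> W" using C by auto
    from Bi[OF _ _ this] b show False by simp
  qed
  have ind: "independent (B \<union> C)"
    unfolding independent_explicit_finite_subsets
  proof (intro allI impI)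
    fix S u assume S: "S \<subseteq> B \<union> C" "finite S" and z: "(\<Sum>v\<in>S. u v *\<^sub>R v) = 0"
    have SBC: "S = (S \<inter> B) \<union> (S \<inter> C)" using S by blast
    have sp: "(\<Sum>v\<in>S. u v *\<^sub>R v) = (\<Sum>v\<in>S \<inter> B. u v *\<^sub>R v) + (\<Sum>v\<in>S \<inter> C. u v *\<^sub>R v)"
      by (subst SBC, rule sum.union_disjoint) (use S disj in auto)
    have inC: "(\<Sum>v\<in>S \<inter> C. u v *\<^sub>R v) \<in> W"
      by (rule subspace_sum[OF W(1)], rule subspace_scale[OF W(1)]) (use C in auto)
    have "(\<Sum>v\<in>S \<inter> B. u v *\<^sub>R v) = - (\<Sum>v\<in>S \<inter> C. u v *\<^sub>R v)"
      using sp z by (simp add: eq_neg_iff_add_eq_0)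
    then have "(\<Sum>v\<in>S \<inter> B. u v *\<^sub>R v) \<in> W" using inC W(1) subspace_neg by metis
    then have uB: "\<forall>b\<in>S \<inter> B. u b = 0" using S by (intro Bi) auto
    then have "(\<Sum>v\<in>S \<inter> B. u v *\<^sub>R v) = 0" by (intro sum.neutral) simp
    then have "(\<Sum>v\<in>S \<inter> C. u v *\<^sub>R v) = 0" using sp z by simp
    then have "\<forall>b\<in>S \<inter> C. u b = 0"
      using C(2) S unfolding independent_explicit_finite_subsets
      by (meson Int_lower2 finite_Int)
    with uB SBC show "\<forall>v\<in>S. u v = 0" by blast
  qed
  have "U \<subseteq> span (B \<union> C)"
  proof
    fix u assume "u \<in> U"
    then obtain v where "v \<in> span B" "u - v \<in> span C" using Bs spC by blast
    then have "v + (u - v) \<in> span (B \<union> C)"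
      by (meson span_add span_mono subsetD sup_ge1 sup_ge2)
    then show "u \<in> span (B \<union> C)" by simp
  qed
  moreover have "B \<union> C \<subseteq> U" using BU C W by blast
  ultimately have card: "card (B \<union> C) = dim U" using ind basis_card_eq_dim by blast
  show finB: "finite B"
    using finite_if_independent_if_finite_span[OF ind _ U(3)] BU C W U by blast
  show "independent B" using ind by (rule independent_mono) simp
  have "dim U = card B + dim W"
    using card card_Un_disjoint[OF finB finC disj] C by simp
  then show "card B = dim U - dim W" "dim W \<le> dim U" by simp_all
qed

lemma quotient_basis_exists:
  fixes U W :: "'b::real_vector set"
  assumes "subspace U" "subspace W" "W \<subseteq> U"
  obtains B where "quotient_basis U W B"
proof -
  obtain C where C: "C \<subseteq> W" "independent C" "W \<subseteq> span C" "card C = dim W"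
    by (rule basis_exists)
  have "C \<subseteq> U" using C assms by blast
  obtain A where A: "C \<subseteq> A" "A \<subseteq> U" "independent A" "U \<subseteq> span A"
    by (rule maximal_independent_subset_extend[OF \<open>C \<subseteq> U\<close> C(2)])
  have AC: "(A - C) \<union> C = A" and spC: "span C = W"
    using A span_subspace[OF C(1,3) assms(2)] by blast+
  have "quotient_basis U W (A - C)"
    by (rule quotient_basis_if_complement[OF assms C(2) spC])
      (use A in \<open>simp_all only: AC, auto\<close>)
  then show thesis by (rule that)
qed

lemma quotient_dim_eq:
  fixes U W :: "'b::real_vector set"
  assumes "subspace U" "U \<subseteq> span G" "finite G" "subspace W" "W \<subseteq> U"
  shows "quotient_dim U W = dim U - dim W"
proof -
  have "quotient_basis U W (SOME B. quotient_basis U W B)"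
    using quotient_basis_exists[OF assms(1,4,5)] by (metis someI)
  then show ?thesis unfolding quotient_dim_def using card_quotient_basis assms by blast
qed

text \<open>A basis of \<open>U\<close> modulo the kernel is mapped bijectively to a basis of the image. The statement is
  relative to a subspace \<open>U\<close> of a possibly infinite-dimensional space, as the chain algebra is.\<close>

lemma rank_nullity:
  fixes f :: "'b::real_vector \<Rightarrow> 'c::real_vector"
  assumes f: "linear f" and U: "subspace U" "U \<subseteq> span G" "finite G"
  shows "dim U = dim {u \<in> U. f u = 0} + dim (f ` U)"
proof -
  let ?W = "{u \<in> U. f u = 0}"
  have W: "subspace ?W" "?W \<subseteq> U"
    using subspace_inter[OF U(1) linear_subspace_kernel[OF f]] by (auto simp: Int_def)
  obtain B where B: "quotient_basis U ?W B" using quotient_basis_exists[OF U(1) W] .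
  note cB = card_quotient_basis[OF U W B]
  have BU: "B \<subseteq> U" using B unfolding quotient_basis_def by blast
  have spBU: "span B \<subseteq> U" using BU U(1) by (rule span_minimal)
  have inj: "inj_on f (span B)"
  proof (rule inj_onI)
    fix x y assume xy: "x \<in> span B" "y \<in> span B" "f x = f y"
    then have k: "x - y \<in> ?W" "x - y \<in> span B"
      using spBU by (auto simp: linear_diff[OF f] intro: span_diff subspace_diff[OF U(1)])
    then obtain t r where t: "finite t" "t \<subseteq> B" "x - y = (\<Sum>a\<in>t. r a *\<^sub>R a)"
      unfolding span_explicit by blast
    then have "(\<Sum>a\<in>t. r a *\<^sub>R a) \<in> ?W" using k by simp
    then have "\<forall>a\<in>t. r a = 0" using t B unfolding quotient_basis_def by blast
    then have "x - y = 0" using t by simp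
    then show "x = y" by simp
  qed
  have "f ` U \<subseteq> f ` span B"
  proof
    fix z assume "z \<in> f ` U"
    then obtain u where u: "u \<in> U" "z = f u" by blast
    then obtain v where "v \<in> span B" "f (u - v) = 0"
      using B unfolding quotient_basis_def by blast
    then show "z \<in> f ` span B" using u by (auto simp: linear_diff[OF f])
  qed
  then have fU: "f ` U = span (f ` B)"
    using spBU by (auto simp: linear_span_image[OF f])
  have "independent (f ` B)"
    by (rule linear_independent_injective_image[OF f cB(3) inj])
  then have "dim (f ` U) = card (f ` B)"
    by (simp add: fU dim_eq_card_independent)
  also have "\<dots> = card B"
    using inj span_superset by (intro card_image) (rule inj_on_subset)
  finally show ?thesis using cB by simp
qed

text \<open>The elements with one coordinate 1 and the others 0 are a basis: subtracting from any element the
  combination with its coordinates leaves an element without coordinates.\<close>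

lemma dim_eq_card_coordinates:
  fixes K :: "'b::real_vector set" and co :: "'j \<Rightarrow> 'b \<Rightarrow> real"
  assumes K: "subspace K" and J: "finite J" and co: "\<And>j. j \<in> J \<Longrightarrow> linear (co j)"
    and inj: "\<And>x. x \<in> K \<Longrightarrow> (\<And>j. j \<in> J \<Longrightarrow> co j x = 0) \<Longrightarrow> x = 0"
    and surj: "\<And>j. j \<in> J \<Longrightarrow> \<exists>x\<in>K. \<forall>i\<in>J. co i x = (if i = j then 1 else 0)"
  shows "dim K = card J"
proof -
  obtain X where X: "\<And>j. j \<in> J \<Longrightarrow> X j \<in> K"
    "\<And>i j. j \<in> J \<Longrightarrow> i \<in> J \<Longrightarrow> co i (X j) = (if i = j then 1 else 0)"
    using surj by metis
  have injX: "inj_on X J"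
  proof (rule inj_onI)
    fix i j assume "i \<in> J" "j \<in> J" "X i = X j"
    then have "co i (X j) = 1" using X(2)[of i i] by simp
    then show "i = j" using X(2)[of j i] \<open>i \<in> J\<close> \<open>j \<in> J\<close> by (auto split: if_splits)
  qed
  have coS: "co i (\<Sum>j\<in>J. r j *\<^sub>R X j) = r i" if "i \<in> J" for i r
  proof -
    have "co i (\<Sum>j\<in>J. r j *\<^sub>R X j) = (\<Sum>j\<in>J. r j * co i (X j))"
      by (simp add: linear_sum[OF co[OF that]] linear_scale[OF co[OF that]])
    also have "\<dots> = (\<Sum>j\<in>J. if i = j then r j else 0)"
      by (rule sum.cong) (use X that in auto)
    finally show ?thesis using that J by simp
  qed
  have "independent (X ` J)"
    unfolding independent_explicit_finite_subsets
  proof (intro allI impI ballI)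
    fix S u v assume S: "S \<subseteq> X ` J" "finite S" "(\<Sum>v\<in>S. u v *\<^sub>R v) = 0" "v \<in> S"
    define r where "r j = (if X j \<in> S then u (X j) else 0)" for j
    have "(\<Sum>j\<in>J. r j *\<^sub>R X j) = (\<Sum>v\<in>X ` J. (if v \<in> S then u v else 0) *\<^sub>R v)"
      by (simp add: sum.reindex[OF injX] r_def)
    also have "\<dots> = (\<Sum>v\<in>S. u v *\<^sub>R v)"
      by (rule sum.mono_neutral_cong_right) (use S J in auto)
    finally have z: "(\<Sum>j\<in>J. r j *\<^sub>R X j) = 0" using S by simp
    obtain i where i: "i \<in> J" "v = X i" using S by blast
    have "r i = co i 0" using coS[OF i(1), of r] z by simp
    then have "r i = 0" by (simp add: linear_0[OF co[OF i(1)]])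
    then show "u v = 0" using i S by (simp add: r_def)
  qed
  moreover have "K \<subseteq> span (X ` J)"
  proof
    fix x assume x: "x \<in> K"
    define y where "y = (\<Sum>j\<in>J. co j x *\<^sub>R X j)"
    have y: "y \<in> K" unfolding y_def
      by (rule subspace_sum[OF K], rule subspace_scale[OF K]) (use X in auto)
    have "x - y = 0"
      by (rule inj) (use x y K coS in \<open>auto simp: subspace_diff linear_diff[OF co] y_def\<close>)
    then have "x = y" by simp
    also have "y \<in> span (X ` J)" unfolding y_def
      by (intro span_sum span_scale span_base) auto
    finally show "x \<in> span (X ` J)" .
  qed
  moreover have "X ` J \<subseteq> K" using X by auto
  ultimately have "card (X ` J) = dim K" using basis_card_eq_dim by blast
  then show ?thesis using injX card_image by metis
qed

section \<open>Linear extension from words\<close>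

definition linext :: "('k \<Rightarrow> 'm::real_vector) \<Rightarrow> ('k \<Rightarrow>\<^sub>0 real) \<Rightarrow> 'm" where
  "linext f p = (\<Sum>k\<in>Poly_Mapping.keys p. Poly_Mapping.lookup p k *\<^sub>R f k)"

lemma linext_superset:
  assumes "finite A" "Poly_Mapping.keys p \<subseteq> A"
  shows "linext f p = (\<Sum>k\<in>A. Poly_Mapping.lookup p k *\<^sub>R f k)"
  unfolding linext_def
  by (rule sum.mono_neutral_left) (use assms in \<open>auto simp: in_keys_iff\<close>)

lemma linear_linext: "linear (linext f)"
proof (rule linearI)
  fix p q :: "'a \<Rightarrow>\<^sub>0 real" and r :: real
  let ?A = "Poly_Mapping.keys p \<union> Poly_Mapping.keys q"
  have "Poly_Mapping.keys (p + q) \<subseteq> ?A" by (rule Poly_Mapping.keys_add)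
  then show "linext f (p + q) = linext f p + linext f q"
    by (simp add: linext_superset[of ?A] lookup_add scaleR_left_distrib sum.distrib)
  have "Poly_Mapping.keys (r *\<^sub>R p) \<subseteq> Poly_Mapping.keys p"
    by (auto simp: in_keys_iff lookup_scaleR)
  then show "linext f (r *\<^sub>R p) = r *\<^sub>R linext f p"
    by (simp add: linext_superset[of "Poly_Mapping.keys p"] lookup_scaleR scaleR_sum_right)
qed

abbreviation unit :: "'k \<Rightarrow> ('k \<Rightarrow>\<^sub>0 real)" where
  "unit k \<equiv> Poly_Mapping.single k 1"

lemma linext_unit [simp]: "linext f (unit k) = f k"
  by (simp add: linext_def)

lemma linext_id: "linext unit p = p"
proof (rule poly_mapping_eqI)
  fix k
  have "Poly_Mapping.lookup (linext unit p) k =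
      (\<Sum>i\<in>Poly_Mapping.keys p. Poly_Mapping.lookup p i * (1 when i = k))"
    by (simp add: linext_def lookup_sum lookup_scaleR lookup_single)
  also have "\<dots> = (\<Sum>i\<in>Poly_Mapping.keys p. if i = k then Poly_Mapping.lookup p i else 0)"
    by (rule sum.cong) (auto simp: when_def)
  also have "\<dots> = Poly_Mapping.lookup p k"
    by (simp add: in_keys_iff)
  finally show "Poly_Mapping.lookup (linext unit p) k = Poly_Mapping.lookup p k" .
qed

lemma span_units: "Poly_Mapping.keys p \<subseteq> S \<Longrightarrow> p \<in> span (unit ` S)"
  by (subst linext_id[symmetric], unfold linext_def)
    (intro span_sum span_scale span_base; blast)

lemma linear_eq_on_units:
  assumes "linear f" "linear g" "\<And>k. f (unit k) = g (unit k)"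
  shows "f p = g p"
proof -
  have "p \<in> span (range unit)" by (rule span_units) simp
  then show ?thesis using linear_eq_on[OF assms(1,2)] assms(3) by blast
qed

lemma linear_lookup: "linear (\<lambda>p :: 'k \<Rightarrow>\<^sub>0 real. Poly_Mapping.lookup p k)"
  by (rule linearI) (simp_all add: lookup_add lookup_scaleR)

text \<open>Words of generators span every algebra below, so that linearity reduces the ideal to the
  elements \<open>u * s * v\<close> with words \<open>u\<close> and \<open>v\<close>.\<close>

lemma linear_vanishes_on_ideal:
  fixes \<phi> :: "'b::{real_algebra, monoid_mult} \<Rightarrow> 'm::real_vector"
  assumes \<phi>: "linear \<phi>" and G: "span G = UNIV"
    and vanish: "\<And>a s b. a \<in> G \<Longrightarrow> b \<in> G \<Longrightarrow> s \<in> S \<Longrightarrow> \<phi> (a * s * b) = 0"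
    and x: "x \<in> two_sided_ideal S"
  shows "\<phi> x = 0"
proof -
  have lin: "linear (\<lambda>a. \<phi> (a * s * b))" "linear (\<lambda>b. \<phi> (a * s * b))" for a s b
    by (auto intro!: linearI simp: linear_add[OF \<phi>] linear_scale[OF \<phi>] algebra_simps)
  have 1: "\<phi> (a * s * b) = 0" if "a \<in> G" "s \<in> S" for a s b
    using linear_eq_0_on_span[OF lin(2), of G a s b] vanish that G by auto
  have 2: "\<phi> (a * s * b) = 0" if "s \<in> S" for a s b
    using linear_eq_0_on_span[OF lin(1), of G s b a] 1 that G by auto
  show ?thesis
    using x unfolding two_sided_ideal_def
    by (rule linear_eq_0_on_span[OF \<phi>, rotated]) (use 2 in blast)
qed

lemma linear_descends:
  fixes abs :: "'b::real_vector \<Rightarrow> 'c::real_vector" and f :: "'b \<Rightarrow> 'm::real_vector"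
  assumes abs: "linear abs" "\<And>t. \<exists>p. t = abs p" and f: "linear f" "\<And>p. abs p = 0 \<Longrightarrow> f p = 0"
  obtains \<phi> where "linear \<phi>" "\<And>p. \<phi> (abs p) = f p"
proof -
  obtain rep where rep: "\<And>t. abs (rep t) = t" using abs(2) by metis
  have eq: "f (rep (abs p)) = f p" for p
    using f(2)[of "rep (abs p) - p"] by (simp add: rep linear_diff[OF abs(1)] linear_diff[OF f(1)])
  have "linear (\<lambda>t. f (rep t))"
  proof (rule linearI)
    fix s t and c :: real
    show "f (rep (s + t)) = f (rep s) + f (rep t)"
      using eq[of "rep s + rep t"]
      by (simp add: rep linear_add[OF abs(1)] linear_add[OF f(1)])
    show "f (rep (c *\<^sub>R t)) = c *\<^sub>R f (rep t)"
      using eq[of "c *\<^sub>R rep t"]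
      by (simp add: rep linear_scale[OF abs(1)] linear_scale[OF f(1)])
  qed
  then show thesis using eq by (rule that)
qed

text \<open>Working with functions of words rather than with algebra homomorphisms gives linear maps into
  arbitrary vector spaces: linear functionals in the exterior algebra, and coordinates for chains.\<close>

definition multilinear :: "('v::real_vector list \<Rightarrow> 'm::real_vector) \<Rightarrow> bool" where
  "multilinear F \<longleftrightarrow> (\<forall>us vs. linear (\<lambda>x. F (us @ x # vs)))"

lemma multilinearD: "multilinear F \<Longrightarrow> linear (\<lambda>x. F (us @ x # vs))"
  by (simp add: multilinear_def)

fun letters :: "'a word \<Rightarrow> 'a list" where
  "letters (Word xs) = xs"

lemma linear_abs_tensor: "linear abs_tensor"
  by (rule linearI) (simp_all add: plus_tensor.abs_eq scaleR_tensor.abs_eq)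

lemma abs_tensor_mult: "abs_tensor (p * q) = abs_tensor p * abs_tensor q"
  by (simp add: times_tensor.abs_eq)

lemma prod_list_tensor_of: "prod_list (map tensor_of xs) = abs_tensor (unit (Word xs))"
proof (induction xs)
  case Nil
  have "(1 :: 'a word \<Rightarrow>\<^sub>0 real) = unit (Word [])"
    by (simp flip: zero_word_def)
  then show ?case by (simp add: one_tensor_def)
next
  case (Cons x xs)
  then show ?case
    by (simp add: tensor_of.abs_eq abs_tensor_mult[symmetric] letter_def mult_single)
qed

lemma tensor_span: "span (range (\<lambda>xs. prod_list (map tensor_of xs))) = UNIV"
proof -
  have "t \<in> span (range (\<lambda>xs. prod_list (map tensor_of xs)))" for t :: "'a tensor"
  proof (induction t rule: tensor.abs_induct)
    case (1 p)
    have "p \<in> span (range unit)" by (rule span_units) simp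
    then have "abs_tensor p \<in> span (abs_tensor ` range unit)"
      using linear_span_image[OF linear_abs_tensor] by blast
    moreover have "abs_tensor ` range unit \<subseteq> range (\<lambda>xs. prod_list (map tensor_of xs))"
      by (auto simp: prod_list_tensor_of) (metis letters.cases rangeI)
    ultimately show ?case using span_mono by blast
  qed
  then show ?thesis by blast
qed

text \<open>The free algebra has the words as a basis, so any function of words extends linearly;
  multilinearity says that the extension kills the relations imposed on the letters.\<close>

lemma linear_factor_tensor:
  fixes F :: "'v::real_vector list \<Rightarrow> 'm::real_vector"
  assumes F: "multilinear F"
  obtains \<phi> where "linear \<phi>" "\<And>xs. \<phi> (prod_list (map tensor_of xs)) = F xs"
proof -
  let ?f = "linext (\<lambda>w. F (letters w))"
  have sp: "span (range unit) = (UNIV :: ('v word \<Rightarrow>\<^sub>0 real) set)"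
    by (auto intro: span_units)
  have van: "?f x = 0" if "x \<in> two_sided_ideal linear_relations" for x
  proof (rule linear_vanishes_on_ideal[OF linear_linext sp _ that])
    fix a s b :: "'v word \<Rightarrow>\<^sub>0 real"
    assume "a \<in> range unit" "b \<in> range unit" and s: "s \<in> linear_relations"
    then obtain us vs where ab: "a = unit (Word us)" "b = unit (Word vs)"
      by (metis letters.cases imageE)
    have w: "?f (a * letter x * b) = F (us @ x # vs)" for x
      by (simp add: ab letter_def mult_single)
    have add: "?f (a * (letter (x + y) - letter x - letter y) * b) = 0" for x y
      by (simp only: left_diff_distrib right_diff_distrib linear_diff[OF linear_linext] w
          linear_add[OF multilinearD[OF F]]) simp
    have scale: "?f (a * (letter (c *\<^sub>R x) - c *\<^sub>R letter x) * b) = 0" for c x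
      by (simp only: left_diff_distrib right_diff_distrib mult_scaleR_left mult_scaleR_right
          linear_diff[OF linear_linext] linear_scale[OF linear_linext] w
          linear_scale[OF multilinearD[OF F]]) simp
    show "?f (a * s * b) = 0"
      using s add scale unfolding linear_relations_def by blast
  qed
  obtain \<phi> where \<phi>: "linear \<phi>" "\<And>p. \<phi> (abs_tensor p) = ?f p"
  proof (rule linear_descends[OF linear_abs_tensor _ linear_linext])
    show "\<exists>p. t = abs_tensor p" for t :: "'v tensor"
      by (induction t rule: tensor.abs_induct) blast
    show "?f p = 0" if "abs_tensor p = 0" for p
      using that by (intro van) (simp add: zero_tensor_def tensor.abs_eq_iff)
  qed blast
  show thesis by (rule that[OF \<phi>(1)]) (simp add: \<phi>(2) prod_list_tensor_of)
qed

lemma linear_abs_exterior: "linear abs_exterior"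
  by (rule linearI) (simp_all add: plus_exterior.abs_eq scaleR_exterior.abs_eq)

lemma wedge_eq_abs: "wedge as = abs_exterior (prod_list (map tensor_of as))"
  unfolding wedge_def
  by (induction as) (simp_all add: one_exterior.abs_eq exterior_of.abs_eq times_exterior.abs_eq)

text \<open>A multilinear function that vanishes on words with two equal neighbours is 0 on every word around a
  square, hence on the ideal of squares.\<close>

lemma linear_factor_exterior:
  fixes F :: "'v::real_vector list \<Rightarrow> 'm::real_vector"
  assumes F: "multilinear F" and alt: "\<And>us x vs. F (us @ x # x # vs) = 0"
  obtains \<phi> where "linear \<phi>" "\<And>as. \<phi> (wedge as) = F as"
proof -
  obtain f where f: "linear f" "\<And>xs. f (prod_list (map tensor_of xs)) = F xs"
    using linear_factor_tensor[OF F] by blast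
  have van: "f x = 0" if "x \<in> two_sided_ideal square_relations" for x
  proof (rule linear_vanishes_on_ideal[OF f(1) tensor_span _ that])
    fix a s b :: "'v tensor"
    assume "a \<in> range (\<lambda>xs. prod_list (map tensor_of xs))"
      "b \<in> range (\<lambda>xs. prod_list (map tensor_of xs))" and "s \<in> square_relations"
    then obtain us vs x where abs: "a = prod_list (map tensor_of us)"
      "b = prod_list (map tensor_of vs)" "s = tensor_of x * tensor_of x"
      unfolding square_relations_def by blast
    have "a * s * b = prod_list (map tensor_of (us @ x # x # vs))"
      by (simp add: abs mult.assoc)
    then show "f (a * s * b) = 0" by (simp only: f(2) alt)
  qed
  obtain \<phi> where \<phi>: "linear \<phi>" "\<And>p. \<phi> (abs_exterior p) = f p"
  proof (rule linear_descends[OF linear_abs_exterior _ f(1)])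
    show "\<exists>p. t = abs_exterior p" for t :: "'v exterior"
      by (induction t rule: exterior.abs_induct) blast
    show "f p = 0" if "abs_exterior p = 0" for p
      using that by (intro van) (simp add: zero_exterior_def exterior.abs_eq_iff)
  qed blast
  show thesis by (rule that[OF \<phi>(1)]) (simp add: \<phi>(2) wedge_eq_abs f(2))
qed

lemma linear_abs_chain: "linear abs_chain"
  by (rule linearI) (simp_all add: plus_chain.abs_eq scaleR_chain.abs_eq)

lemma chain_prod_eq_abs: "chain_prod Ys = abs_chain (prod_list (map tensor_of Ys))"
  unfolding chain_prod_def
  by (induction Ys) (simp_all add: one_chain.abs_eq chain_of_def times_chain.abs_eq)

lemma chain_prod_span: "span (range chain_prod) = UNIV"
proof -
  have "c \<in> span (range chain_prod)" for c :: "'a chain"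
  proof (induction c rule: chain.abs_induct)
    case (1 t)
    have "t \<in> span (range (\<lambda>xs. prod_list (map tensor_of xs)))" using tensor_span by blast
    then have "abs_chain t \<in> span (abs_chain ` range (\<lambda>xs. prod_list (map tensor_of xs)))"
      using linear_span_image[OF linear_abs_chain] by blast
    then show ?case by (simp add: image_image chain_prod_eq_abs[symmetric])
  qed
  then show ?thesis by blast
qed

text \<open>Likewise the sign rule for exchanging two homogeneous neighbours is the vanishing on every word
  around a supersymmetry relation.\<close>

lemma linear_factor_chain:
  fixes F :: "'v::real_vector superspace list \<Rightarrow> 'm::real_vector"
  assumes F: "multilinear F"
    and sym: "\<And>us X Y vs x y. X \<in> grade x \<Longrightarrow> Y \<in> grade y \<Longrightarrow>
      F (us @ X # Y # vs) + (-1) ^ (x * y) *\<^sub>R F (us @ Y # X # vs) = 0"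
  obtains \<phi> where "linear \<phi>" "\<And>Ys. \<phi> (chain_prod Ys) = F Ys"
proof -
  obtain f where f: "linear f" "\<And>xs. f (prod_list (map tensor_of xs)) = F xs"
    using linear_factor_tensor[OF F] by blast
  have van: "f x = 0" if "x \<in> two_sided_ideal supersymmetry_relations" for x
  proof (rule linear_vanishes_on_ideal[OF f(1) tensor_span _ that])
    fix a s b :: "'v superspace tensor"
    assume "a \<in> range (\<lambda>xs. prod_list (map tensor_of xs))"
      "b \<in> range (\<lambda>xs. prod_list (map tensor_of xs))" and "s \<in> supersymmetry_relations"
    then obtain us vs X Y x y where abs: "a = prod_list (map tensor_of us)"
      "b = prod_list (map tensor_of vs)" "X \<in> grade x" "Y \<in> grade y"
      "s = tensor_of X * tensor_of Y + (-1) ^ (x * y) *\<^sub>R (tensor_of Y * tensor_of X)"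
      unfolding supersymmetry_relations_def by blast
    have "a * s * b = prod_list (map tensor_of (us @ X # Y # vs)) +
        (-1) ^ (x * y) *\<^sub>R prod_list (map tensor_of (us @ Y # X # vs))"
      by (simp add: abs algebra_simps)
    then show "f (a * s * b) = 0"
      by (simp only: f(2) linear_add[OF f(1)] linear_scale[OF f(1)] sym[OF abs(3,4)])
  qed
  obtain \<phi> where \<phi>: "linear \<phi>" "\<And>p. \<phi> (abs_chain p) = f p"
  proof (rule linear_descends[OF linear_abs_chain _ f(1)])
    show "\<exists>p. t = abs_chain p" for t :: "'v chain"
      by (induction t rule: chain.abs_induct) blast
    show "f p = 0" if "abs_chain p = 0" for p
      using that by (intro van) (simp add: zero_chain_def chain.abs_eq_iff)
  qed blast
  show thesis by (rule that[OF \<phi>(1)]) (simp add: \<phi>(2) chain_prod_eq_abs f(2))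
qed

section \<open>The exterior algebra of a three-dimensional space\<close>

lemma two_sided_ideal_base: "s \<in> S \<Longrightarrow> s \<in> two_sided_ideal S"
  unfolding two_sided_ideal_def
  by (rule span_base) (metis (mono_tags, lifting) mem_Collect_eq mult_1_left mult_1_right)

lemma linear_tensor_of: "linear tensor_of"
proof (rule linearI)
  fix x y :: 'a and c :: real
  have "letter (x + y) - letter x - letter y \<in> two_sided_ideal linear_relations"
    by (rule two_sided_ideal_base) (auto simp: linear_relations_def)
  then show "tensor_of (x + y) = tensor_of x + tensor_of y"
    by (simp add: tensor_of.abs_eq plus_tensor.abs_eq tensor.abs_eq_iff algebra_simps)
  have "letter (c *\<^sub>R x) - c *\<^sub>R letter x \<in> two_sided_ideal linear_relations"
    by (rule two_sided_ideal_base) (auto simp: linear_relations_def)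
  then show "tensor_of (c *\<^sub>R x) = c *\<^sub>R tensor_of x"
    by (simp add: tensor_of.abs_eq scaleR_tensor.abs_eq tensor.abs_eq_iff)
qed

lemma linear_exterior_of: "linear exterior_of"
  by (rule linearI)
    (simp_all add: exterior_of.abs_eq plus_exterior.abs_eq scaleR_exterior.abs_eq
      linear_add[OF linear_tensor_of] linear_scale[OF linear_tensor_of])

lemma exterior_of_square: "exterior_of x * exterior_of x = 0"
proof -
  have "tensor_of x * tensor_of x - 0 \<in> two_sided_ideal square_relations"
    by (simp, rule two_sided_ideal_base) (auto simp: square_relations_def)
  then show ?thesis
    by (simp add: exterior_of.abs_eq times_exterior.abs_eq zero_exterior_def exterior.abs_eq_iff)
qed

lemma exterior_of_anticommute: "exterior_of y * exterior_of x = - (exterior_of x * exterior_of y)"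
proof -
  have "exterior_of (x + y) * exterior_of (x + y) = 0" by (rule exterior_of_square)
  then have "exterior_of x * exterior_of y + exterior_of y * exterior_of x = 0"
    by (simp add: linear_add[OF linear_exterior_of] distrib_left distrib_right exterior_of_square add.commute)
  then show ?thesis by (simp add: eq_neg_iff_add_eq_0 add.commute)
qed

lemma linear_Rep_superspace: "linear Rep_superspace"
  by (rule linearI) (simp_all add: plus_superspace.rep_eq scaleR_superspace.rep_eq)

lemma superspace_span: "span {swedge as | as. as \<noteq> []} = UNIV"
proof -
  let ?S = "span {swedge as | as. as \<noteq> []} :: 'a superspace set"
  have "subspace (Rep_superspace ` ?S)"
    by (rule linear_subspace_image[OF linear_Rep_superspace subspace_span])
  moreover have "{wedge as | as. as \<noteq> []} \<subseteq> Rep_superspace ` ?S"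
    by (auto simp flip: Rep_swedge intro!: imageI span_base)
  ultimately have "span {wedge as | as. as \<noteq> []} \<subseteq> Rep_superspace ` ?S"
    by (rule span_minimal[rotated])
  then have "Rep_superspace X \<in> Rep_superspace ` ?S" for X
    using Rep_superspace[of X] by (rule subsetD)
  then have "\<exists>Y \<in> ?S. X = Y" for X
    unfolding image_iff Rep_superspace_inject .
  then show ?thesis by blast
qed

text \<open>Names for the basis of the superspace: \<open>Z1, Z2, Z3\<close> of grade 0 are the basis of the Lie algebra, with
  \<open>[Z1, Z2] = Z3\<close> central, \<open>U1 = Z2 \<and> Z3\<close>, \<open>U2 = Z1 \<and> Z3\<close>, \<open>U3 = Z1 \<and> Z2\<close> have grade 1, and
  \<open>V = Z1 \<and> Z2 \<and> Z3\<close> has grade 2.\<close>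

datatype gen = Z1 | Z2 | Z3 | U1 | U2 | U3 | V

lemma UNIV_gen: "UNIV = {Z1, Z2, Z3, U1, U2, U3, V}"
  using gen.exhaust by blast

fun gr :: "gen \<Rightarrow> nat" where
  "gr Z1 = 0" | "gr Z2 = 0" | "gr Z3 = 0" | "gr U1 = 1" | "gr U2 = 1" | "gr U3 = 1" | "gr V = 2"

lemma list_cases_upto_3:
  obtains "xs = []" | a where "xs = [a]" | a b where "xs = [a, b]" | a b c where "xs = [a, b, c]"
  | a b c d ys where "xs = a # b # c # d # ys"
  by (metis list.exhaust)

locale heisenberg =
  fixes br :: "'a::real_vector \<Rightarrow> 'a \<Rightarrow> 'a" and z1 z2 z3 :: 'a and c1 c2 c3 :: "'a \<Rightarrow> real"
  assumes linear_c: "linear c1" "linear c2" "linear c3"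
    and dual: "c1 z1 = 1" "c1 z2 = 0" "c1 z3 = 0" "c2 z1 = 0" "c2 z2 = 1" "c2 z3 = 0"
      "c3 z1 = 0" "c3 z2 = 0" "c3 z3 = 1"
    and expand: "x = c1 x *\<^sub>R z1 + c2 x *\<^sub>R z2 + c3 x *\<^sub>R z3"
    and br_eq: "br x y = (c1 x * c2 y - c2 x * c1 y) *\<^sub>R z3"
begin

lemma c_br: "c1 (br x y) = 0" "c2 (br x y) = 0" "c3 (br x y) = c1 x * c2 y - c2 x * c1 y"
  by (simp_all add: br_eq linear_scale linear_c dual)

fun basis_word :: "gen \<Rightarrow> 'a list" where
  "basis_word Z1 = [z1]" | "basis_word Z2 = [z2]" | "basis_word Z3 = [z3]"
| "basis_word U1 = [z2, z3]" | "basis_word U2 = [z1, z3]" | "basis_word U3 = [z1, z2]"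
| "basis_word V = [z1, z2, z3]"

definition E :: "gen \<Rightarrow> 'a superspace" where
  "E g = swedge (basis_word g)"

text \<open>The minors of the coordinate matrix of a word are the coordinates of its wedge product. They
  vanish on words of the wrong length.\<close>

fun minor :: "gen \<Rightarrow> 'a list \<Rightarrow> real" where
  "minor Z1 [x] = c1 x"
| "minor Z2 [x] = c2 x"
| "minor Z3 [x] = c3 x"
| "minor U1 [x, y] = c2 x * c3 y - c3 x * c2 y"
| "minor U2 [x, y] = c1 x * c3 y - c3 x * c1 y"
| "minor U3 [x, y] = c1 x * c2 y - c2 x * c1 y"
| "minor V [x, y, z] = c1 x * (c2 y * c3 z - c3 y * c2 z) - c2 x * (c1 y * c3 z - c3 y * c1 z)
     + c3 x * (c1 y * c2 z - c2 y * c1 z)"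
| "minor g as = 0"

lemma minor_long [simp]: "minor g (a # b # c # d # xs) = 0"
  by (cases g) simp_all

lemma minor_Nil [simp]: "minor g [] = 0"
  by (cases g) simp_all

lemma multilinear_minor: "multilinear (minor g)"
  unfolding multilinear_def
proof (intro allI)
  fix us vs
  have zero: "linear (\<lambda>x::'a. 0::real)" by (rule linearI) simp_all
  have mult: "linear (\<lambda>x. f x * r)" "linear (\<lambda>x. r * f x)"
    if "linear f" for f :: "'a \<Rightarrow> real" and r
    using that by (auto intro!: linearI simp: linear_add linear_scale algebra_simps)
  show "linear (\<lambda>x. minor g (us @ x # vs))"
    by (rule list_cases_upto_3[of us]; rule list_cases_upto_3[of vs]; hypsubst; cases g; hypsubst;
        simp only: append.simps minor.simps minor_long;
        intro linear_compose_add linear_compose_sub mult linear_c zero)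
qed

lemma minor_alternating: "minor g (us @ x # x # vs) = 0"
  by (rule list_cases_upto_3[of us]; rule list_cases_upto_3[of vs]; cases g; simp add: algebra_simps)

text \<open>The coordinates of the superspace. They exist because the minors are multilinear and alternating;
  this is what keeps the wedge products of basis vectors linearly independent.\<close>

definition co :: "gen \<Rightarrow> 'a superspace \<Rightarrow> real" where
  "co g = (SOME f. linear f \<and> (\<forall>as. as \<noteq> [] \<longrightarrow> f (swedge as) = minor g as))"

lemma co: "linear (co g)" "as \<noteq> [] \<Longrightarrow> co g (swedge as) = minor g as"
proof -
  obtain f where f: "linear f" "\<And>as. f (wedge as) = minor g as"
    using linear_factor_exterior[OF multilinear_minor minor_alternating] by blast
  have "linear (\<lambda>X. f (Rep_superspace X)) \<and>
      (\<forall>as. as \<noteq> [] \<longrightarrow> f (Rep_superspace (swedge as)) = minor g as)"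
    using linear_compose[OF linear_Rep_superspace f(1)] by (simp add: f(2) Rep_swedge o_def)
  then have "\<exists>h. linear h \<and> (\<forall>as. as \<noteq> [] \<longrightarrow> h (swedge as) = minor g as)" by blast
  from someI_ex[OF this] show "linear (co g)" "as \<noteq> [] \<Longrightarrow> co g (swedge as) = minor g as"
    unfolding co_def by blast+
qed

lemma co_E: "co g (E h) = (if g = h then 1 else 0)"
  by (cases h; cases g) (simp_all add: E_def co(2) dual)

lemma exterior_of_expand:
  "exterior_of x = c1 x *\<^sub>R exterior_of z1 + c2 x *\<^sub>R exterior_of z2 + c3 x *\<^sub>R exterior_of z3"
  by (subst expand[of x])
    (simp only: linear_add[OF linear_exterior_of] linear_scale[OF linear_exterior_of])

text \<open>Rewriting with these rules sorts a product of basis vectors and deletes repetitions.\<close>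

lemma exterior_reorder:
  "exterior_of z2 * exterior_of z1 = - (exterior_of z1 * exterior_of z2)"
  "exterior_of z3 * exterior_of z1 = - (exterior_of z1 * exterior_of z3)"
  "exterior_of z3 * exterior_of z2 = - (exterior_of z2 * exterior_of z3)"
  "exterior_of z2 * (exterior_of z1 * t) = - (exterior_of z1 * (exterior_of z2 * t))"
  "exterior_of z3 * (exterior_of z1 * t) = - (exterior_of z1 * (exterior_of z3 * t))"
  "exterior_of z3 * (exterior_of z2 * t) = - (exterior_of z2 * (exterior_of z3 * t))"
  "exterior_of z * (exterior_of z * t) = 0"
  by (simp_all add: exterior_of_anticommute[of z2 z1] exterior_of_anticommute[of z3 z1]
      exterior_of_anticommute[of z3 z2] exterior_of_square flip: mult.assoc)

lemma wedge_1: "wedge [x] = c1 x *\<^sub>R wedge [z1] + c2 x *\<^sub>R wedge [z2] + c3 x *\<^sub>R wedge [z3]"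
  by (simp add: wedge_def flip: exterior_of_expand)

lemma wedge_2:
  "wedge [x, y] = minor U1 [x, y] *\<^sub>R wedge [z2, z3] + minor U2 [x, y] *\<^sub>R wedge [z1, z3]
     + minor U3 [x, y] *\<^sub>R wedge [z1, z2]"
  by (simp add: wedge_def exterior_of_expand[of x] exterior_of_expand[of y] exterior_reorder
      exterior_of_square algebra_simps)

lemma wedge_3: "wedge [x, y, z] = minor V [x, y, z] *\<^sub>R wedge [z1, z2, z3]"
  by (simp add: wedge_def exterior_of_expand[of x] exterior_of_expand[of y] exterior_of_expand[of z]
      exterior_reorder exterior_of_square algebra_simps)

lemma wedge_4: "wedge (a # b # c # d # xs :: 'a list) = 0"
proof -
  have "wedge (a # b # c # d # xs) = wedge [a, b, c] * exterior_of d * wedge xs"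
    by (simp add: wedge_def mult.assoc)
  also have "wedge [a, b, c] * exterior_of d = 0"
    by (subst wedge_3, subst exterior_of_expand[of d])
      (simp add: wedge_def exterior_reorder exterior_of_square algebra_simps)
  finally show ?thesis by simp
qed

lemma swedge_expand:
  assumes "as \<noteq> []"
  shows "swedge as = (\<Sum>g\<in>UNIV. minor g as *\<^sub>R E g)"
proof -
  have "wedge as = (\<Sum>g\<in>UNIV. minor g as *\<^sub>R wedge (basis_word g))"
  proof (cases as rule: list_cases_upto_3)
    case (2 a)
    show ?thesis unfolding 2 by (subst wedge_1) (simp add: UNIV_gen)
  next
    case (3 a b)
    show ?thesis unfolding 3 by (subst wedge_2) (simp add: UNIV_gen)
  next
    case (4 a b c)
    show ?thesis unfolding 4 by (subst wedge_3) (simp add: UNIV_gen)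
  qed (use assms in \<open>simp_all add: wedge_4\<close>)
  moreover have "basis_word g \<noteq> []" for g by (cases g) simp_all
  ultimately have "Rep_superspace (swedge as) = Rep_superspace (\<Sum>g\<in>UNIV. minor g as *\<^sub>R E g)"
    by (simp add: linear_sum[OF linear_Rep_superspace] linear_scale[OF linear_Rep_superspace]
        Rep_swedge E_def assms)
  then show ?thesis by (simp add: Rep_superspace_inject)
qed

lemma superspace_expand: "X = (\<Sum>g\<in>UNIV. co g X *\<^sub>R E g)"
proof -
  have "linear (\<lambda>X. X)" by (rule linearI) simp_all
  moreover have "linear (\<lambda>X. \<Sum>g\<in>UNIV. co g X *\<^sub>R E g)"
    by (rule linearI) (simp_all add: linear_add[OF co(1)] linear_scale[OF co(1)]
        scaleR_left_distrib sum.distrib scaleR_sum_right)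
  ultimately show ?thesis
    by (rule linear_eq_on[of _ _ X "{swedge as | as. as \<noteq> []}"])
      (auto simp: superspace_span co(2) simp flip: swedge_expand)
qed

lemma E_in_grade: "E g \<in> grade (gr g)"
  unfolding grade_def E_def by (rule span_base) (cases g; force)

lemma grade_eq: "grade i = span (E ` {g. gr g = i})"
proof
  have "swedge as \<in> span (E ` {g. gr g = i})" if "length as = i + 1" for as
  proof -
    have "minor g as *\<^sub>R E g \<in> span (E ` {g. gr g = i})" for g
    proof (cases "gr g = i")
      case True
      then show ?thesis by (intro span_scale span_base) blast
    next
      case False
      then have "minor g as = 0"
        using that by (cases as rule: list_cases_upto_3; cases g) auto
      then show ?thesis by (simp add: span_zero)
    qed
    moreover have "as \<noteq> []" using that by auto
    ultimately show ?thesis by (simp add: swedge_expand span_sum)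
  qed
  then show "grade i \<subseteq> span (E ` {g. gr g = i})"
    unfolding grade_def by (intro span_minimal subspace_span) auto
  show "span (E ` {g. gr g = i}) \<subseteq> grade i"
    using E_in_grade by (intro span_minimal) (auto simp: grade_def)
qed

section \<open>The Schouten bracket\<close>

text \<open>Bilinear extension of the only nonzero brackets of basis elements: \<open>[Z1, Z2] = Z3\<close>, \<open>[Z1, U3] = U2\<close>,
  \<open>[Z2, U3] = U1\<close>, \<open>[U3, U3] = 2 V\<close>, and those that follow by graded antisymmetry.\<close>

definition sbracket :: "'a superspace \<Rightarrow> 'a superspace \<Rightarrow> 'a superspace" where
  "sbracket X Y = (co Z1 X * co Z2 Y - co Z2 X * co Z1 Y) *\<^sub>R E Z3
     + (co Z1 X * co U3 Y - co U3 X * co Z1 Y) *\<^sub>R E U2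
     + (co Z2 X * co U3 Y - co U3 X * co Z2 Y) *\<^sub>R E U1
     + (2 * co U3 X * co U3 Y) *\<^sub>R E V"

lemma bilinear_sbracket: "bilinear sbracket"
  unfolding bilinear_def
  by (auto intro!: linearI simp: sbracket_def linear_add[OF co(1)] linear_scale[OF co(1)] algebra_simps)

lemma swedge_long: "length as \<ge> 4 \<Longrightarrow> swedge (as :: 'a list) = 0"
  by (cases as rule: list_cases_upto_3) (simp_all add: swedge_expand)

lemma superspace_eqI: "(\<And>g. co g X = co g Y) \<Longrightarrow> X = Y"
  by (subst superspace_expand[of X], subst superspace_expand[of Y]) simp

text \<open>The bracket of words of lengths \<open>k\<close> and \<open>l\<close> consists of wedge products of length \<open>k + l - 1\<close>. Only
  finitely many shapes therefore occur up to total length 4, and there both sides agree as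
  polynomials in the coordinates of the letters.\<close>

lemma sbracket_swedge_short:
  assumes "as \<noteq> []" "bs \<noteq> []" "length as + length bs \<le> 4"
  shows "sbracket (swedge as) (swedge bs) =
    (\<Sum>i<length as. \<Sum>j<length bs.
       (-1) ^ (i + j) *\<^sub>R swedge (br (as ! i) (bs ! j) # omit i as @ omit j bs))"
proof (rule superspace_eqI)
  fix g
  show "co g (sbracket (swedge as) (swedge bs)) = co g (\<Sum>i<length as. \<Sum>j<length bs.
       (-1) ^ (i + j) *\<^sub>R swedge (br (as ! i) (bs ! j) # omit i as @ omit j bs))"
    using assms
    by (cases as rule: list_cases_upto_3; cases bs rule: list_cases_upto_3; hypsubst; cases g;
        hypsubst;
        simp add: sbracket_def co co_E linear_0[OF co(1)] linear_add[OF co(1)] linear_diff[OF co(1)] linear_neg[OF co(1)]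
          linear_scale[OF co(1)] omit_def lessThan_Suc c_br;
        simp add: algebra_simps)
qed

text \<open>Beyond total length 4 both sides vanish, because wedge products of length at least 4 do.\<close>

lemma sbracket_swedge:
  assumes "as \<noteq> []" "bs \<noteq> []"
  shows "sbracket (swedge as) (swedge bs) =
    (\<Sum>i<length as. \<Sum>j<length bs.
       (-1) ^ (i + j) *\<^sub>R swedge (br (as ! i) (bs ! j) # omit i as @ omit j bs))"
proof (cases "length as + length bs \<le> 4")
  case True
  with assms show ?thesis by (rule sbracket_swedge_short)
next
  case False
  then have "swedge (br (as ! i) (bs ! j) # omit i as @ omit j bs) = 0"
    if "i < length as" "j < length bs" for i j
    using that by (intro swedge_long) (auto simp: omit_def)
  moreover have "sbracket (swedge as) (swedge bs) = 0"
    using assms False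
    by (cases as rule: list_cases_upto_3; cases bs rule: list_cases_upto_3)
      (simp_all add: sbracket_def co(2))
  ultimately show ?thesis by simp
qed

lemma schouten_eq: "schouten br = sbracket"
  unfolding schouten_def
proof (rule the_equality)
  show "bilinear sbracket \<and> (\<forall>as bs. as \<noteq> [] \<longrightarrow> bs \<noteq> [] \<longrightarrow> sbracket (swedge as) (swedge bs) =
      (\<Sum>i<length as. \<Sum>j<length bs.
         (-1) ^ (i + j) *\<^sub>R swedge (br (as ! i) (bs ! j) # omit i as @ omit j bs)))"
    by (intro conjI allI impI bilinear_sbracket sbracket_swedge)
next
  fix C assume C: "bilinear C \<and> (\<forall>as bs. as \<noteq> [] \<longrightarrow> bs \<noteq> [] \<longrightarrow> C (swedge as) (swedge bs) =
      (\<Sum>i<length as. \<Sum>j<length bs.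
         (-1) ^ (i + j) *\<^sub>R swedge (br (as ! i) (bs ! j) # omit i as @ omit j bs)))"
  show "C = sbracket"
  proof (intro ext)
    fix X Y
    show "C X Y = sbracket X Y"
      by (rule bilinear_eq[of C sbracket UNIV "{swedge as | as. as \<noteq> []}" UNIV "{swedge as | as. as \<noteq> []}"])
        (use C bilinear_sbracket sbracket_swedge in \<open>auto simp: superspace_span\<close>)
  qed
qed

end

section \<open>Monomials and their boundary\<close>

text \<open>\<open>Mon a1 a2 a3 e p q r\<close> stands for the ordered product of the anticommuting factors \<open>Z1, Z2, Z3, V\<close>, present
  according to the Booleans, and of \<open>U1 ^ p\<close>, \<open>U2 ^ q\<close>, \<open>U3 ^ r\<close>. With the commuting \<open>U\<close>-factors at the end,
  multiplication from the left never moves past a power, so no sign depends on an exponent.\<close>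

datatype mono = Mon bool bool bool bool nat nat nat

text \<open>The sign for moving a generator past an optional factor.\<close>

fun sg :: "bool \<Rightarrow> real" where
  "sg True = -1" | "sg False = 1"

fun lmul_mono :: "gen \<Rightarrow> mono \<Rightarrow> (mono \<Rightarrow>\<^sub>0 real)" where
  "lmul_mono Z1 (Mon a1 a2 a3 e p q r) = (if a1 then 0 else unit (Mon True a2 a3 e p q r))"
| "lmul_mono Z2 (Mon a1 a2 a3 e p q r) =
     (if a2 then 0 else sg a1 *\<^sub>R unit (Mon a1 True a3 e p q r))"
| "lmul_mono Z3 (Mon a1 a2 a3 e p q r) =
     (if a3 then 0 else (sg a1 * sg a2) *\<^sub>R unit (Mon a1 a2 True e p q r))"
| "lmul_mono V (Mon a1 a2 a3 e p q r) =
     (if e then 0 else (sg a1 * sg a2 * sg a3) *\<^sub>R unit (Mon a1 a2 a3 True p q r))"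
| "lmul_mono U1 (Mon a1 a2 a3 e p q r) =
     (sg a1 * sg a2 * sg a3 * sg e) *\<^sub>R unit (Mon a1 a2 a3 e (Suc p) q r)"
| "lmul_mono U2 (Mon a1 a2 a3 e p q r) =
     (sg a1 * sg a2 * sg a3 * sg e) *\<^sub>R unit (Mon a1 a2 a3 e p (Suc q) r)"
| "lmul_mono U3 (Mon a1 a2 a3 e p q r) =
     (sg a1 * sg a2 * sg a3 * sg e) *\<^sub>R unit (Mon a1 a2 a3 e p q (Suc r))"

definition lmul :: "gen \<Rightarrow> (mono \<Rightarrow>\<^sub>0 real) \<Rightarrow> (mono \<Rightarrow>\<^sub>0 real)" where
  "lmul g = linext (lmul_mono g)"

text \<open>The boundary contracts two factors of a monomial into their bracket. The four summands come from
  \<open>[Z1, Z2] = Z3\<close>, \<open>[Z1, U3] = U2\<close>, \<open>[Z2, U3] = U1\<close> and \<open>[U3, U3] = 2 V\<close>; the last one occurs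
  \<open>r (r - 1) / 2\<close> times. Where the truncated subtraction of exponents is wrong, the coefficient is 0.\<close>

fun bd_mono :: "mono \<Rightarrow> (mono \<Rightarrow>\<^sub>0 real)" where
  "bd_mono (Mon a1 a2 a3 e p q r) =
     (if a1 \<and> a2 \<and> \<not> a3 then unit (Mon False False True e p q r) else 0)
   + (if a1 then real r *\<^sub>R unit (Mon False a2 a3 e p (Suc q) (r - 1)) else 0)
   + (if a2 then (sg a1 * real r) *\<^sub>R unit (Mon a1 False a3 e (Suc p) q (r - 1)) else 0)
   + (if e then 0 else (sg a1 * sg a2 * sg a3 * (real r * (real r - 1))) *\<^sub>R
        unit (Mon a1 a2 a3 True p q (r - 2)))"

definition bd :: "(mono \<Rightarrow>\<^sub>0 real) \<Rightarrow> (mono \<Rightarrow>\<^sub>0 real)" where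
  "bd = linext bd_mono"

lemma linear_lmul: "linear (lmul g)" and linear_bd: "linear bd"
  by (simp_all add: lmul_def bd_def linear_linext)

lemma lmul_unit: "lmul g (unit m) = lmul_mono g m" and bd_unit: "bd (unit m) = bd_mono m"
  by (simp_all add: lmul_def bd_def)

lemmas lmul_linear = linear_0[OF linear_lmul] linear_add[OF linear_lmul] linear_diff[OF linear_lmul]
  linear_neg[OF linear_lmul] linear_scale[OF linear_lmul]

lemmas bd_linear = linear_0[OF linear_bd] linear_add[OF linear_bd] linear_diff[OF linear_bd]
  linear_neg[OF linear_bd] linear_scale[OF linear_bd]

text \<open>Expanding scalar numerals into sums lets associativity and commutativity of addition compare linear
  combinations of monomials whose coefficients are integer polynomials in an exponent.\<close>

lemma scaleR_numeral_expand:
  fixes v :: "'b::real_vector"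
  shows "numeral (num.Bit0 n) *\<^sub>R v = numeral n *\<^sub>R v + numeral n *\<^sub>R v"
    "numeral (num.Bit1 n) *\<^sub>R v = numeral n *\<^sub>R v + numeral n *\<^sub>R v + v"
    "(x * numeral (num.Bit0 n)) *\<^sub>R v = (x * numeral n) *\<^sub>R v + (x * numeral n) *\<^sub>R v"
    "(x * numeral (num.Bit1 n)) *\<^sub>R v = (x * numeral n) *\<^sub>R v + (x * numeral n) *\<^sub>R v + x *\<^sub>R v"
    "(x * (y * numeral (num.Bit0 n))) *\<^sub>R v =
       (x * (y * numeral n)) *\<^sub>R v + (x * (y * numeral n)) *\<^sub>R v"
    "(x * (y * numeral (num.Bit1 n))) *\<^sub>R v =
       (x * (y * numeral n)) *\<^sub>R v + (x * (y * numeral n)) *\<^sub>R v + (x * y) *\<^sub>R v"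
  by (simp_all only: numeral_Bit0 numeral_Bit1 distrib_left scaleR_left_distrib mult_1_right scaleR_one)

lemma lmul_supercommute: "lmul g (lmul h x) + (-1) ^ (gr g * gr h) *\<^sub>R lmul h (lmul g x) = 0"
proof -
  have "linear (\<lambda>x. lmul g (lmul h x) + (-1) ^ (gr g * gr h) *\<^sub>R lmul h (lmul g x))"
    by (rule linearI) (simp_all add: lmul_linear algebra_simps scaleR_numeral_expand)
  moreover have "linear (\<lambda>x :: mono \<Rightarrow>\<^sub>0 real. 0 :: mono \<Rightarrow>\<^sub>0 real)"
    by (rule linearI) simp_all
  ultimately show ?thesis
  proof (rule linear_eq_on_units)
    fix m
    obtain a1 a2 a3 e p q r where m: "m = Mon a1 a2 a3 e p q r" by (cases m)
    show "lmul g (lmul h (unit m)) + (-1) ^ (gr g * gr h) *\<^sub>R lmul h (lmul g (unit m)) = 0"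
      unfolding m by (cases g; cases h; simp add: lmul_unit lmul_linear)
  qed
qed

fun lmul_br :: "gen \<Rightarrow> gen \<Rightarrow> (mono \<Rightarrow>\<^sub>0 real) \<Rightarrow> (mono \<Rightarrow>\<^sub>0 real)" where
  "lmul_br Z1 Z2 x = lmul Z3 x"
| "lmul_br Z2 Z1 x = - lmul Z3 x"
| "lmul_br Z1 U3 x = lmul U2 x"
| "lmul_br U3 Z1 x = - lmul U2 x"
| "lmul_br Z2 U3 x = lmul U1 x"
| "lmul_br U3 Z2 x = - lmul U1 x"
| "lmul_br U3 U3 x = 2 *\<^sub>R lmul V x"
| "lmul_br g h x = 0"

text \<open>The adjoint action of a generator on monomials, as a superderivation: it replaces each factor by
  its bracket with the generator. Only \<open>Z1\<close>, \<open>Z2\<close> and \<open>U3\<close> have nonzero brackets.\<close>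

fun ad_mono :: "gen \<Rightarrow> mono \<Rightarrow> (mono \<Rightarrow>\<^sub>0 real)" where
  "ad_mono Z1 (Mon a1 a2 a3 e p q r) =
     (if a2 \<and> \<not> a3 then unit (Mon a1 False True e p q r) else 0)
   + real r *\<^sub>R unit (Mon a1 a2 a3 e p (Suc q) (r - 1))"
| "ad_mono Z2 (Mon a1 a2 a3 e p q r) =
     (if a1 \<and> \<not> a3 then - sg a2 *\<^sub>R unit (Mon False a2 True e p q r) else 0)
   + real r *\<^sub>R unit (Mon a1 a2 a3 e (Suc p) q (r - 1))"
| "ad_mono U3 (Mon a1 a2 a3 e p q r) =
     (if a1 then - (sg a2 * sg a3 * sg e) *\<^sub>R unit (Mon False a2 a3 e p (Suc q) r) else 0)
   + (if a2 then - (sg a3 * sg e) *\<^sub>R unit (Mon a1 False a3 e (Suc p) q r) else 0)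
   + (if e then 0 else (2 * real r) *\<^sub>R unit (Mon a1 a2 a3 True p q (r - 1)))"
| "ad_mono g m = 0"

definition ad :: "gen \<Rightarrow> (mono \<Rightarrow>\<^sub>0 real) \<Rightarrow> (mono \<Rightarrow>\<^sub>0 real)" where
  "ad g = linext (ad_mono g)"

lemma linear_ad: "linear (ad g)"
  by (simp add: ad_def linear_linext)

lemma ad_unit: "ad g (unit m) = ad_mono g m"
  by (simp add: ad_def)

lemmas ad_linear = linear_0[OF linear_ad] linear_add[OF linear_ad] linear_diff[OF linear_ad]
  linear_neg[OF linear_ad] linear_scale[OF linear_ad]

lemma nat_cases_upto_1:
  fixes r :: nat
  obtains "r = 0" | "r = 1" | k where "r = Suc (Suc k)"
  by (metis One_nat_def not0_implies_Suc)

text \<open>The boundary of a product \<open>g * x\<close> either brackets the first factor with a later one, which is the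
  adjoint action, or contracts two later factors, which moves past \<open>g\<close> at the cost of the sign
  \<open>(-1) ^ i\<close> in the boundary formula. Together with the Leibniz rule for the action, this recursion
  determines the boundary of every word.\<close>

lemma bd_lmul: "bd (lmul g x) = ad g x - lmul g (bd x)"
proof (rule linear_eq_on_units[of "\<lambda>x. bd (lmul g x)" "\<lambda>x. ad g x - lmul g (bd x)"])
  show "linear (\<lambda>x. bd (lmul g x))" "linear (\<lambda>x. ad g x - lmul g (bd x))"
    by (auto intro!: linearI simp: lmul_linear bd_linear ad_linear algebra_simps scaleR_numeral_expand)
next
  fix m
  obtain a1 a2 a3 e p q r where m: "m = Mon a1 a2 a3 e p q r" by (cases m)
  show "bd (lmul g (unit m)) = ad g (unit m) - lmul g (bd (unit m))"
    unfolding m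
    by (rule nat_cases_upto_1[of r]; hypsubst; cases a1; cases a2; cases a3; cases e;
        cases g; simp add: lmul_unit bd_unit ad_unit lmul_linear bd_linear algebra_simps scaleR_numeral_expand)
qed

text \<open>The super Leibniz rule: bracketing with \<open>g\<close> either hits the factor \<open>h\<close> or passes it, with the sign of
  their grades.\<close>

lemma ad_lmul: "ad g (lmul h x) = lmul_br g h x + (-1) ^ (gr g * gr h) *\<^sub>R lmul h (ad g x)"
proof (rule linear_eq_on_units[of "\<lambda>x. ad g (lmul h x)"
      "\<lambda>x. lmul_br g h x + (-1) ^ (gr g * gr h) *\<^sub>R lmul h (ad g x)"])
  have "linear (lmul_br g h)"
    by (cases g; cases h; rule linearI; simp add: lmul_linear algebra_simps scaleR_numeral_expand)
  then show "linear (\<lambda>x. ad g (lmul h x))"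
    "linear (\<lambda>x. lmul_br g h x + (-1) ^ (gr g * gr h) *\<^sub>R lmul h (ad g x))"
    by (auto intro!: linearI simp: lmul_linear ad_linear linear_add linear_scale algebra_simps scaleR_numeral_expand)
next
  fix m
  obtain a1 a2 a3 e p q r where m: "m = Mon a1 a2 a3 e p q r" by (cases m)
  have trivial: "ad g (lmul h y) = lmul_br g h y + (-1) ^ (gr g * gr h) *\<^sub>R lmul h (ad g y)"
    if "g \<in> {Z3, U1, U2, V}" for y
  proof -
    have "ad g y = 0" for y
      using that linear_eq_on_units[OF linear_ad linear_zero, of g] by (auto simp: ad_unit)
    moreover have "lmul_br g h y = 0" for y using that by auto
    ultimately show ?thesis by (simp add: lmul_linear)
  qed
  have "ad g (lmul h (unit m)) =
      lmul_br g h (unit m) + (-1) ^ (gr g * gr h) *\<^sub>R lmul h (ad g (unit m))"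
    if "g \<in> {Z1, Z2, U3}"
    unfolding m
    by (cases a1; cases a2; cases a3; cases e; cases r; hypsubst;
        insert that; elim insertE emptyE; hypsubst; cases h;
        simp add: lmul_unit ad_unit lmul_linear ad_linear algebra_simps scaleR_numeral_expand)
  moreover have "g \<in> {Z1, Z2, U3} \<or> g \<in> {Z3, U1, U2, V}" by (cases g) auto
  ultimately show "ad g (lmul h (unit m)) =
      lmul_br g h (unit m) + (-1) ^ (gr g * gr h) *\<^sub>R lmul h (ad g (unit m))"
    using trivial[of "unit m"] by blast
qed

lemma nat_cases_upto_2:
  fixes r :: nat
  obtains "r = 0" | "r = 1" | "r = 2" | k where "r = Suc (Suc (Suc k))"
  by (metis One_nat_def Suc_1 not0_implies_Suc)

lemma bd_bd: "bd (bd x) = 0"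
proof -
  have "linear (\<lambda>x. bd (bd x))" "linear (\<lambda>x :: mono \<Rightarrow>\<^sub>0 real. 0 :: mono \<Rightarrow>\<^sub>0 real)"
    by (auto intro!: linearI simp: bd_linear)
  then show ?thesis
  proof (rule linear_eq_on_units)
    fix m
    obtain a1 a2 a3 e p q r where m: "m = Mon a1 a2 a3 e p q r" by (cases m)
    show "bd (bd (unit m)) = 0"
      unfolding m
      by (rule nat_cases_upto_2[of r]; hypsubst; cases a1; cases a2; cases a3; cases e; simp add: bd_unit bd_linear;
          simp add: algebra_simps scaleR_numeral_expand)
  qed
qed

section \<open>The normal form of a chain\<close>

lemma linear_chain_of: "linear chain_of"
  by (rule linearI)
    (simp_all add: chain_of_def linear_add[OF linear_tensor_of] linear_scale[OF linear_tensor_of]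
      plus_chain.abs_eq scaleR_chain.abs_eq)

lemma chain_of_supercommute:
  assumes "X \<in> grade x" "Y \<in> grade y"
  shows "chain_of X * chain_of Y + (-1) ^ (x * y) *\<^sub>R (chain_of Y * chain_of X) = 0"
proof -
  have "tensor_of X * tensor_of Y + (-1) ^ (x * y) *\<^sub>R (tensor_of Y * tensor_of X) - 0
      \<in> two_sided_ideal supersymmetry_relations"
    using assms by (simp, intro two_sided_ideal_base) (auto simp: supersymmetry_relations_def)
  then show ?thesis
    by (simp add: chain_of_def times_chain.abs_eq plus_chain.abs_eq scaleR_chain.abs_eq
        zero_chain_def chain.abs_eq_iff)
qed

lemma chain_prod_Cons: "chain_prod (X # Ys) = chain_of X * chain_prod Ys"
  by (simp add: chain_prod_def)

abbreviation mono_one :: mono where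
  "mono_one \<equiv> Mon False False False False 0 0 0"

context heisenberg
begin

definition Lmul :: "'a superspace \<Rightarrow> (mono \<Rightarrow>\<^sub>0 real) \<Rightarrow> (mono \<Rightarrow>\<^sub>0 real)" where
  "Lmul X v = (\<Sum>g\<in>UNIV. co g X *\<^sub>R lmul g v)"

lemma Lmul_E: "Lmul (E h) v = lmul h v"
  by (simp add: Lmul_def co_E if_distrib[of "\<lambda>r. r *\<^sub>R _"] UNIV_gen) (cases h; simp)

lemma linear_Lmul: "linear (Lmul X)"
  by (rule linearI) (simp_all add: Lmul_def lmul_linear scaleR_right_distrib sum.distrib
      scaleR_sum_right mult.commute)

lemma linear_Lmul_left: "linear (\<lambda>X. Lmul X v)"
  by (rule linearI) (simp_all add: Lmul_def linear_add[OF co(1)] linear_scale[OF co(1)]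
      scaleR_left_distrib sum.distrib scaleR_sum_right)

lemmas Lmul_linear = linear_0[OF linear_Lmul] linear_add[OF linear_Lmul]
  linear_diff[OF linear_Lmul] linear_neg[OF linear_Lmul] linear_scale[OF linear_Lmul]
  linear_0[OF linear_Lmul_left] linear_add[OF linear_Lmul_left]
  linear_scale[OF linear_Lmul_left]

text \<open>Each homogeneous component is spanned by the basis elements of its grade. The grades have to be
  fixed first, because the signs in the identities depend on them.\<close>

lemma homogeneous_bilinear_zero:
  fixes \<Phi> :: "'a superspace \<Rightarrow> 'a superspace \<Rightarrow> 'm::real_vector"
  assumes lin: "\<And>Y. linear (\<lambda>X. \<Phi> X Y)" "\<And>X. linear (\<Phi> X)"
    and zero: "\<And>g h. gr g = x \<Longrightarrow> gr h = y \<Longrightarrow> \<Phi> (E g) (E h) = 0"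
    and "X \<in> grade x" "Y \<in> grade y"
  shows "\<Phi> X Y = 0"
proof -
  have "\<Phi> (E g) Y = 0" if "gr g = x" for g
    using linear_eq_0_on_span[OF lin(2), of "E ` {h. gr h = y}" "E g" Y] zero that assms(5)
    by (auto simp: grade_eq)
  then show ?thesis
    using linear_eq_0_on_span[OF lin(1), of "E ` {g. gr g = x}" Y X] assms(4)
    by (auto simp: grade_eq)
qed

lemma Lmul_supercommute:
  assumes "X \<in> grade x" "Y \<in> grade y"
  shows "Lmul X (Lmul Y v) + (-1) ^ (x * y) *\<^sub>R Lmul Y (Lmul X v) = 0"
proof (rule homogeneous_bilinear_zero[OF _ _ _ assms,
    where \<Phi> = "\<lambda>X Y. Lmul X (Lmul Y v) + (-1) ^ (x * y) *\<^sub>R Lmul Y (Lmul X v)"])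
  fix g h assume "gr g = x" "gr h = y"
  then show "Lmul (E g) (Lmul (E h) v) + (-1) ^ (x * y) *\<^sub>R Lmul (E h) (Lmul (E g) v) = 0"
    using lmul_supercommute[of g h v] by (simp add: Lmul_E)
qed (auto intro!: linearI simp: Lmul_linear algebra_simps)

definition normal :: "'a superspace list \<Rightarrow> (mono \<Rightarrow>\<^sub>0 real)" where
  "normal Ys = foldr Lmul Ys (unit mono_one)"

lemma linear_foldr_Lmul: "linear (foldr Lmul us)"
proof (induction us)
  case Nil
  show ?case by (rule linearI) simp_all
next
  case (Cons X us)
  show ?case using linear_compose[OF Cons linear_Lmul[of X]] by (simp add: o_def)
qed

lemma multilinear_normal: "multilinear normal"
  unfolding multilinear_def normal_def
proof (intro allI)
  fix us vs
  show "linear (\<lambda>x. foldr Lmul (us @ x # vs) (unit mono_one))"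
    using linear_compose[OF linear_Lmul_left linear_foldr_Lmul] by (simp add: o_def)
qed

text \<open>The normal form respects the relations of the chain algebra and so descends to a linear map. This
  is the step that keeps the ordered monomials linearly independent in the quotient.\<close>

definition \<Phi> :: "'a chain \<Rightarrow> (mono \<Rightarrow>\<^sub>0 real)" where
  "\<Phi> = (SOME f. linear f \<and> (\<forall>Ys. f (chain_prod Ys) = normal Ys))"

lemma linear_\<Phi>: "linear \<Phi>" and \<Phi>_chain_prod: "\<Phi> (chain_prod Ys) = normal Ys"
proof -
  have "normal (us @ X # Y # vs) + (-1) ^ (x * y) *\<^sub>R normal (us @ Y # X # vs) = 0"
    if "X \<in> grade x" "Y \<in> grade y" for us vs X Y x y
  proof -
    let ?f = "foldr Lmul us" and ?v = "foldr Lmul vs (unit mono_one)"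
    have "normal (us @ X # Y # vs) + (-1) ^ (x * y) *\<^sub>R normal (us @ Y # X # vs)
        = ?f (Lmul X (Lmul Y ?v) + (-1) ^ (x * y) *\<^sub>R Lmul Y (Lmul X ?v))"
      by (simp add: normal_def linear_add[OF linear_foldr_Lmul] linear_scale[OF linear_foldr_Lmul])
    also have "\<dots> = 0"
      by (simp add: Lmul_supercommute[OF that] linear_0[OF linear_foldr_Lmul])
    finally show ?thesis .
  qed
  then obtain f where "linear f" "\<And>Ys. f (chain_prod Ys) = normal Ys"
    using linear_factor_chain[OF multilinear_normal] by blast
  then have "\<exists>f. linear f \<and> (\<forall>Ys. f (chain_prod Ys) = normal Ys)" by blast
  from someI_ex[OF this] show "linear \<Phi>" "\<Phi> (chain_prod Ys) = normal Ys"
    unfolding \<Phi>_def by blast+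
qed

lemma \<Phi>_mult: "\<Phi> (chain_of X * c) = Lmul X (\<Phi> c)"
proof -
  have lin: "linear (\<lambda>c. \<Phi> (chain_of X * c))" "linear (\<lambda>c. Lmul X (\<Phi> c))"
    by (auto intro!: linearI simp: linear_add[OF linear_\<Phi>] linear_scale[OF linear_\<Phi>]
        Lmul_linear distrib_left)
  have "\<Phi> (chain_of X * b) = Lmul X (\<Phi> b)" if "b \<in> range chain_prod" for b :: "'a chain"
  proof -
    from that obtain Ys where "b = chain_prod Ys" by blast
    then show ?thesis
      using \<Phi>_chain_prod[of "X # Ys"] by (simp add: \<Phi>_chain_prod chain_prod_Cons normal_def)
  qed
  then show ?thesis
    by (intro linear_eq_on[OF lin, of c "range chain_prod"]) (simp_all add: chain_prod_span)
qed

lemma \<Phi>_1: "\<Phi> 1 = unit mono_one"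
  using \<Phi>_chain_prod[of "[]"] by (simp add: chain_prod_def normal_def)

definition chain_gen :: "gen \<Rightarrow> 'a chain" where
  "chain_gen g = chain_of (E g)"

lemma \<Phi>_chain_gen: "\<Phi> (chain_gen g * c) = lmul g (\<Phi> c)"
  by (simp add: chain_gen_def \<Phi>_mult Lmul_E)

fun \<mu> :: "mono \<Rightarrow> 'a chain" where
  "\<mu> (Mon a1 a2 a3 e p q r) = chain_gen Z1 ^ of_bool a1 * (chain_gen Z2 ^ of_bool a2 * (chain_gen Z3 ^ of_bool a3 *
     (chain_gen V ^ of_bool e * (chain_gen U1 ^ p * (chain_gen U2 ^ q * chain_gen U3 ^ r)))))"

definition \<Psi> :: "(mono \<Rightarrow>\<^sub>0 real) \<Rightarrow> 'a chain" where
  "\<Psi> = linext \<mu>"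

lemma linear_\<Psi>: "linear \<Psi>"
  by (simp add: \<Psi>_def linear_linext)

lemma \<Psi>_unit: "\<Psi> (unit m) = \<mu> m"
  by (simp add: \<Psi>_def)

lemma \<Phi>_\<mu>: "\<Phi> (\<mu> m) = unit m"
proof (cases m)
  case (Mon a1 a2 a3 e p q r)
  have 3: "\<Phi> (chain_gen U3 ^ r) = unit (Mon False False False False 0 0 r)"
    by (induction r) (simp_all add: \<Phi>_1 \<Phi>_chain_gen lmul_unit)
  have 2: "\<Phi> (chain_gen U2 ^ q * chain_gen U3 ^ r) = unit (Mon False False False False 0 q r)"
    by (induction q) (simp_all add: 3 \<Phi>_chain_gen lmul_unit mult.assoc)
  have 1: "\<Phi> (chain_gen U1 ^ p * (chain_gen U2 ^ q * chain_gen U3 ^ r)) = unit (Mon False False False False p q r)"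
    by (induction p) (simp_all add: 2 \<Phi>_chain_gen lmul_unit mult.assoc)
  show ?thesis
    unfolding Mon by (cases a1; cases a2; cases a3; cases e) (simp_all add: \<Phi>_chain_gen 1 lmul_unit)
qed

lemma \<Phi>_\<Psi>: "\<Phi> (\<Psi> v) = v"
proof -
  have "linear (\<lambda>v. \<Phi> (\<Psi> v))" "linear (\<lambda>v :: mono \<Rightarrow>\<^sub>0 real. v)"
    by (auto intro!: linearI simp: linear_add[OF linear_\<Phi>] linear_scale[OF linear_\<Phi>]
        linear_add[OF linear_\<Psi>] linear_scale[OF linear_\<Psi>])
  then show ?thesis by (rule linear_eq_on_units) (simp add: \<Psi>_unit \<Phi>_\<mu>)
qed

lemma chain_gen_supercommute: "chain_gen g * chain_gen h = - ((-1) ^ (gr g * gr h) *\<^sub>R (chain_gen h * chain_gen g))"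
  using chain_of_supercommute[OF E_in_grade E_in_grade, of g h]
  by (simp add: chain_gen_def eq_neg_iff_add_eq_0)

lemma chain_gen_even_square: "even (gr g) \<Longrightarrow> chain_gen g * chain_gen g = 0"
  using chain_gen_supercommute[of g g] by (simp add: eq_neg_iff_add_eq_0 flip: scaleR_2)

lemma chain_gen_swap: "chain_gen g * (chain_gen h * c) = - ((-1) ^ (gr g * gr h) *\<^sub>R (chain_gen h * (chain_gen g * c)))"
  by (simp add: chain_gen_supercommute[of g h] flip: mult.assoc)

lemma chain_gen_even_square_mult: "even (gr g) \<Longrightarrow> chain_gen g * (chain_gen g * c) = 0"
  by (simp add: chain_gen_even_square flip: mult.assoc)

lemma chain_gen_U_power: "gr g = 1 \<Longrightarrow> gr h = 1 \<Longrightarrow> chain_gen g * (chain_gen h ^ n * c) = chain_gen h ^ n * (chain_gen g * c)"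
  by (induction n) (simp_all add: mult.assoc chain_gen_swap[of g h])

text \<open>In the chain algebra a generator can be sorted into an ordered monomial by the relations alone,
  with the signs that define \<^const>\<open>lmul\<close>.\<close>

lemma \<Psi>_lmul: "\<Psi> (lmul g v) = chain_gen g * \<Psi> v"
proof -
  have "linear (\<lambda>v. \<Psi> (lmul g v))" "linear (\<lambda>v. chain_gen g * \<Psi> v)"
    by (auto intro!: linearI simp: linear_add[OF linear_\<Psi>] linear_scale[OF linear_\<Psi>]
        lmul_linear distrib_left)
  then show ?thesis
  proof (rule linear_eq_on_units)
    fix m
    obtain a1 a2 a3 e p q r where m: "m = Mon a1 a2 a3 e p q r" by (cases m)
    note reorder = chain_gen_swap[of Z2 Z1] chain_gen_swap[of Z3 Z1] chain_gen_swap[of Z3 Z2] chain_gen_swap[of V Z1] chain_gen_swap[of V Z2]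
      chain_gen_swap[of V Z3] chain_gen_swap[of U1 Z1] chain_gen_swap[of U1 Z2] chain_gen_swap[of U1 Z3] chain_gen_swap[of U1 V]
      chain_gen_swap[of U2 Z1] chain_gen_swap[of U2 Z2] chain_gen_swap[of U2 Z3] chain_gen_swap[of U2 V]
      chain_gen_swap[of U3 Z1] chain_gen_swap[of U3 Z2] chain_gen_swap[of U3 Z3] chain_gen_swap[of U3 V]
      chain_gen_U_power[of U2 U1] chain_gen_U_power[of U3 U1] chain_gen_U_power[of U3 U2] chain_gen_even_square_mult
    show "\<Psi> (lmul g (unit m)) = chain_gen g * \<Psi> (unit m)"
      unfolding m
      by (cases g; cases a1; cases a2; cases a3; cases e;
          simp add: lmul_unit \<Psi>_unit reorder linear_scale[OF linear_\<Psi>] linear_0[OF linear_\<Psi>]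
            linear_neg[OF linear_\<Psi>] mult.assoc)
  qed
qed

lemma \<Psi>_Lmul: "\<Psi> (Lmul X v) = chain_of X * \<Psi> v"
proof -
  have "chain_of X * \<Psi> v = (\<Sum>g\<in>UNIV. co g X *\<^sub>R (chain_gen g * \<Psi> v))"
    by (subst superspace_expand[of X])
      (simp add: linear_sum[OF linear_chain_of] linear_scale[OF linear_chain_of] chain_gen_def
        sum_distrib_right)
  then show ?thesis
    by (simp add: Lmul_def linear_sum[OF linear_\<Psi>] linear_scale[OF linear_\<Psi>] \<Psi>_lmul)
qed

lemma \<Psi>_normal: "\<Psi> (normal Ys) = chain_prod Ys"
  by (induction Ys) (simp_all add: normal_def chain_prod_def \<Psi>_unit \<Psi>_Lmul)

lemma \<Psi>_\<Phi>: "\<Psi> (\<Phi> c) = c"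
proof -
  have "linear (\<lambda>c. \<Psi> (\<Phi> c))" "linear (\<lambda>c :: 'a chain. c)"
    by (auto intro!: linearI simp: linear_add[OF linear_\<Phi>] linear_scale[OF linear_\<Phi>]
        linear_add[OF linear_\<Psi>] linear_scale[OF linear_\<Psi>])
  then show ?thesis
    by (rule linear_eq_on[of _ _ c "range chain_prod"])
      (auto simp: chain_prod_span \<Phi>_chain_prod \<Psi>_normal)
qed

end

section \<open>The boundary operator in normal form\<close>

lemma greaterThanLessThan_Suc_Suc: "{Suc i<..<Suc n} = Suc ` {i<..<n}"
  and greaterThanLessThan_0_Suc: "{0<..<Suc n} = Suc ` {..<n}"
  by (rule set_eqI, rename_tac x, case_tac x; auto)+

lemma sum_Suc_greaterThanLessThan:
  fixes f :: "nat \<Rightarrow> 'b::comm_monoid_add"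
  shows "(\<Sum>s\<in>{Suc i<..<Suc n}. f s) = (\<Sum>s\<in>{i<..<n}. f (Suc s))"
    "(\<Sum>s\<in>{0<..<Suc n}. f s) = (\<Sum>s<n. f (Suc s))"
  by (simp_all add: greaterThanLessThan_Suc_Suc greaterThanLessThan_0_Suc sum.reindex)

lemma sum_pairs_less:
  fixes f :: "nat \<Rightarrow> nat \<Rightarrow> 'b::comm_monoid_add"
  shows "(\<Sum>(i, j)\<in>{(i, j). i < j \<and> j < n}. f i j) = (\<Sum>i<n. \<Sum>j\<in>{i<..<n}. f i j)"
proof -
  have "{(i, j). i < j \<and> j < n} = Sigma {..<n} (\<lambda>i. {i<..<n})" by auto
  then show ?thesis by (simp add: sum.Sigma)
qed

context heisenberg
begin

lemma Lmul_br: "Lmul (sbracket (E g) (E h)) v = lmul_br g h v"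
  by (cases g; cases h; simp add: sbracket_def co_E Lmul_linear linear_neg[OF linear_Lmul_left] Lmul_E)

text \<open>Defined through the boundary, the action of \<open>X\<close> is linear in \<open>X\<close> by construction, and agrees
  with \<^const>\<open>ad\<close> on basis elements.\<close>

definition Ad :: "'a superspace \<Rightarrow> (mono \<Rightarrow>\<^sub>0 real) \<Rightarrow> (mono \<Rightarrow>\<^sub>0 real)" where
  "Ad X v = bd (Lmul X v) + Lmul X (bd v)"

lemma Ad_E: "Ad (E g) v = ad g v"
  by (simp add: Ad_def Lmul_E bd_lmul)

lemma Ad_Lmul:
  assumes "X \<in> grade x" "Y \<in> grade y"
  shows "Ad X (Lmul Y v) = Lmul (sbracket X Y) v + (-1) ^ (x * y) *\<^sub>R Lmul Y (Ad X v)"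
proof -
  let ?f = "\<lambda>X Y. Ad X (Lmul Y v) - Lmul (sbracket X Y) v - (-1) ^ (x * y) *\<^sub>R Lmul Y (Ad X v)"
  have "?f X Y = 0"
  proof (rule homogeneous_bilinear_zero[OF _ _ _ assms, where \<Phi> = ?f])
    show "linear (\<lambda>X. ?f X Y)" "linear (?f X)" for X Y
      by (auto intro!: linearI simp: Ad_def Lmul_linear bd_linear
          bilinear_ladd[OF bilinear_sbracket] bilinear_radd[OF bilinear_sbracket] bilinear_lmul[OF bilinear_sbracket]
          bilinear_rmul[OF bilinear_sbracket] algebra_simps)
  next
    fix g h assume "gr g = x" "gr h = y"
    then show "?f (E g) (E h) = 0"
      using ad_lmul[of g h v] by (simp add: Ad_E Lmul_E Lmul_br)
  qed
  then show ?thesis by (simp add: algebra_simps)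
qed

lemma Ad_one: "Ad X (unit mono_one) = 0"
proof -
  have "ad g (unit mono_one) = 0" for g by (cases g) (simp_all add: ad_unit)
  then have "bd (lmul g (unit mono_one)) = 0" for g
    by (simp add: bd_lmul bd_unit lmul_linear)
  then show ?thesis
    by (simp add: Ad_def Lmul_def linear_sum[OF linear_bd] bd_linear bd_unit lmul_linear)
qed

definition bdry :: "'a chain \<Rightarrow> 'a chain" where
  "bdry c = \<Psi> (bd (\<Phi> c))"

lemma linear_bdry: "linear bdry"
  by (rule linearI) (simp_all add: bdry_def linear_add[OF linear_\<Phi>] linear_scale[OF linear_\<Phi>]
      linear_add[OF linear_\<Psi>] linear_scale[OF linear_\<Psi>] bd_linear)

text \<open>Iterating the Leibniz rule gives the terms of the boundary formula in which the first factor is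
  bracketed with the \<open>j\<close>-th of the remaining ones.\<close>

lemma \<Psi>_Ad_normal:
  assumes "X \<in> grade x" "homogeneous Zs zs"
  shows "\<Psi> (Ad X (normal Zs)) =
    (\<Sum>j<length Zs. (-1) ^ (x * (\<Sum>s<j. zs ! s)) *\<^sub>R chain_prod (Zs[j := sbracket X (Zs ! j)]))"
  using assms(2) unfolding homogeneous_def
proof (induction rule: list_all2_induct)
  case Nil
  show ?case by (simp add: normal_def Ad_one linear_0[OF linear_\<Psi>])
next
  case (Cons Z Zs z zs)
  have "\<Psi> (Ad X (normal (Z # Zs))) = \<Psi> (Ad X (Lmul Z (normal Zs)))"
    by (simp add: normal_def)
  also have "\<dots> = chain_of (sbracket X Z) * chain_prod Zs +
      (-1) ^ (x * z) *\<^sub>R (chain_of Z * \<Psi> (Ad X (normal Zs)))"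
    by (simp add: Ad_Lmul[OF assms(1) Cons.hyps(1)] linear_add[OF linear_\<Psi>]
        linear_scale[OF linear_\<Psi>] \<Psi>_Lmul \<Psi>_normal)
  also have "\<dots> = (\<Sum>j<length (Z # Zs). (-1) ^ (x * (\<Sum>s<j. (z # zs) ! s)) *\<^sub>R
      chain_prod ((Z # Zs)[j := sbracket X ((Z # Zs) ! j)]))"
    by (simp add: Cons.IH sum.lessThan_Suc_shift chain_prod_def sum_distrib_left scaleR_sum_right
        distrib_left power_add del: sum.lessThan_Suc)
  finally show ?case .
qed

text \<open>Induction on the word: the pairs \<open>(0, j)\<close> give the action of the first factor on the rest, and the
  pairs \<open>(i + 1, j + 1)\<close> give minus the first factor times the boundary of the rest.\<close>

lemma bdry_chain_prod:
  assumes "homogeneous Ys ys"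
  shows "bdry (chain_prod Ys) = (\<Sum>(i, j)\<in>{(i, j). i < j \<and> j < length Ys}.
    (-1) ^ (i + ys ! i * (\<Sum>s\<in>{i<..<j}. ys ! s)) *\<^sub>R
      chain_prod (omit i (Ys[j := sbracket (Ys ! i) (Ys ! j)])))"
  unfolding sum_pairs_less
  using assms unfolding homogeneous_def
proof (induction rule: list_all2_induct)
  case Nil
  show ?case by (simp add: bdry_def \<Phi>_chain_prod normal_def bd_unit linear_0[OF linear_\<Psi>])
next
  case (Cons Y Ys y ys)
  have "bdry (chain_prod (Y # Ys)) = \<Psi> (bd (Lmul Y (normal Ys)))"
    by (simp add: bdry_def \<Phi>_chain_prod normal_def)
  also have "bd (Lmul Y (normal Ys)) = Ad Y (normal Ys) - Lmul Y (bd (normal Ys))"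
    by (simp add: Ad_def)
  also have "\<Psi> \<dots> = \<Psi> (Ad Y (normal Ys)) - chain_of Y * bdry (chain_prod Ys)"
    by (simp add: linear_diff[OF linear_\<Psi>] \<Psi>_Lmul bdry_def \<Phi>_chain_prod)
  also have "\<Psi> (Ad Y (normal Ys)) =
      (\<Sum>j<length Ys. (-1) ^ (y * (\<Sum>s<j. ys ! s)) *\<^sub>R chain_prod (Ys[j := sbracket Y (Ys ! j)]))"
    by (rule \<Psi>_Ad_normal[OF Cons.hyps(1)]) (use Cons.hyps(2) in \<open>simp add: homogeneous_def\<close>)
  finally have 1: "bdry (chain_prod (Y # Ys)) =
      (\<Sum>j<length Ys. (-1) ^ (y * (\<Sum>s<j. ys ! s)) *\<^sub>R chain_prod (Ys[j := sbracket Y (Ys ! j)]))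
      - chain_of Y * bdry (chain_prod Ys)" .
  define T where "T Ys ys i j = (-1) ^ (i + ys ! i * (\<Sum>s\<in>{i<..<j}. ys ! s)) *\<^sub>R
      chain_prod (omit i (Ys[j := sbracket (Ys ! i) (Ys ! j)]))" for Ys ys i j
  have T0: "T (Y # Ys) (y # ys) 0 (Suc j) =
      (-1) ^ (y * (\<Sum>s<j. ys ! s)) *\<^sub>R chain_prod (Ys[j := sbracket Y (Ys ! j)])" for j
    by (simp add: T_def omit_def sum_Suc_greaterThanLessThan)
  have TS: "T (Y # Ys) (y # ys) (Suc i) (Suc j) = - (chain_of Y * T Ys ys i j)" for i j
    by (simp add: T_def omit_def sum_Suc_greaterThanLessThan chain_prod_Cons)
  have IH: "bdry (chain_prod Ys) = (\<Sum>i<length Ys. \<Sum>j\<in>{i<..<length Ys}. T Ys ys i j)"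
    using Cons.IH by (simp only: T_def)
  have "bdry (chain_prod (Y # Ys)) = (\<Sum>j<length Ys. T (Y # Ys) (y # ys) 0 (Suc j))
      + (\<Sum>i<length Ys. \<Sum>j\<in>{i<..<length Ys}. T (Y # Ys) (y # ys) (Suc i) (Suc j))"
    unfolding 1 T0 TS IH by (simp add: sum_distrib_left sum_negf)
  also have "\<dots> = (\<Sum>i<length (Y # Ys). \<Sum>j\<in>{i<..<length (Y # Ys)}. T (Y # Ys) (y # ys) i j)"
    by (simp only: length_Cons sum.lessThan_Suc_shift sum_Suc_greaterThanLessThan)
  finally show ?case by (simp only: T_def)
qed

fun mono_word :: "mono \<Rightarrow> gen list" where
  "mono_word (Mon a1 a2 a3 e p q r) = replicate (of_bool a1) Z1 @ replicate (of_bool a2) Z2 @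
     replicate (of_bool a3) Z3 @ replicate (of_bool e) V @ replicate p U1 @ replicate q U2 @
     replicate r U3"

lemma \<mu>_eq_chain_prod: "\<mu> m = chain_prod (map E (mono_word m))"
  by (cases m) (simp add: chain_prod_def chain_gen_def prod_list_replicate map_replicate)

lemma homogeneous_map_E: "homogeneous (map E gs) (map gr gs)"
  by (simp add: homogeneous_def list_all2_map1 list_all2_map2 E_in_grade list_all2_same)

lemma span_\<mu>: "c \<in> span (range \<mu>)"
proof -
  have "\<Phi> c \<in> span (range unit)" by (rule span_units) simp
  then have "\<Psi> (\<Phi> c) \<in> span (\<Psi> ` range unit)"
    using linear_span_image[OF linear_\<Psi>] by blast
  then show ?thesis by (simp add: \<Psi>_\<Phi> image_image \<Psi>_unit)
qed

text \<open>The monomials are products of homogeneous elements and span the chains, so the formula determines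
  a linear map uniquely.\<close>

lemma boundary_eq: "boundary br = bdry"
  unfolding boundary_def schouten_eq
proof (rule the_equality)
  show "linear bdry \<and> (\<forall>Ys ys. homogeneous Ys ys \<longrightarrow>
        bdry (chain_prod Ys) =
          (\<Sum>(i, j) \<in> {(i, j). i < j \<and> j < length Ys}.
             (-1) ^ (i + ys ! i * (\<Sum>s \<in> {i<..<j}. ys ! s)) *\<^sub>R
               chain_prod (omit i (Ys[j := sbracket (Ys ! i) (Ys ! j)]))))"
    by (intro conjI allI impI linear_bdry bdry_chain_prod)
next
  fix D assume D: "linear D \<and> (\<forall>Ys ys. homogeneous Ys ys \<longrightarrow>
        D (chain_prod Ys) =
          (\<Sum>(i, j) \<in> {(i, j). i < j \<and> j < length Ys}.
             (-1) ^ (i + ys ! i * (\<Sum>s \<in> {i<..<j}. ys ! s)) *\<^sub>R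
               chain_prod (omit i (Ys[j := sbracket (Ys ! i) (Ys ! j)]))))"
  have "D (\<mu> m) = bdry (\<mu> m)" for m
    unfolding \<mu>_eq_chain_prod
    by (rule trans[OF conjunct2[OF D, rule_format, OF homogeneous_map_E]
          bdry_chain_prod[OF homogeneous_map_E, symmetric]])
  then have "D c = bdry c" for c
    using linear_eq_on[OF conjunct1[OF D] linear_bdry span_\<mu>] by blast
  then show "D = bdry" by (rule ext)
qed

end

section \<open>Weight spaces and Betti numbers\<close>

lemma dim_linear_inj_image:
  fixes f :: "'b::real_vector \<Rightarrow> 'c::real_vector"
  assumes f: "linear f" "inj f" and A: "subspace A"
  shows "dim (f ` A) = dim A"
proof -
  obtain C where C: "C \<subseteq> A" "independent C" "A \<subseteq> span C" "card C = dim A"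
    by (rule basis_exists)
  have A_eq: "A = span C" using span_subspace[OF C(1,3) A] by simp
  have "dim (f ` A) = dim (f ` C)"
    unfolding A_eq linear_span_image[OF f(1), symmetric] by simp
  also have "\<dots> = card (f ` C)"
    by (intro dim_eq_card_independent linear_independent_injective_image f(1) C(2)
        inj_on_subset[OF f(2)]) simp
  also have "\<dots> = dim A"
    using C(4) by (simp add: card_image inj_on_subset[OF f(2)])
  finally show ?thesis .
qed

fun deg :: "mono \<Rightarrow> nat" where
  "deg (Mon a1 a2 a3 e p q r) = of_bool a1 + of_bool a2 + of_bool a3 + of_bool e + p + q + r"

fun wt :: "mono \<Rightarrow> nat" where
  "wt (Mon a1 a2 a3 e p q r) = 2 * of_bool e + p + q + r"

definition monomials :: "nat \<Rightarrow> nat \<Rightarrow> mono set" where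
  "monomials m w = {k. deg k = m \<and> wt k = w}"

definition weight_space :: "nat \<Rightarrow> nat \<Rightarrow> (mono \<Rightarrow>\<^sub>0 real) set" where
  "weight_space m w = span (unit ` monomials m w)"

definition cycle_space :: "nat \<Rightarrow> nat \<Rightarrow> (mono \<Rightarrow>\<^sub>0 real) set" where
  "cycle_space m w = {v \<in> weight_space m w. bd v = 0}"

lemma subspace_weight_space: "subspace (weight_space m w)"
  by (simp add: weight_space_def)

lemma subspace_cycle_space: "subspace (cycle_space m w)"
  using subspace_inter[OF subspace_weight_space linear_subspace_kernel[OF linear_bd]]
  by (simp add: cycle_space_def Int_def)

lemma in_weight_space_iff: "v \<in> weight_space m w \<longleftrightarrow> Poly_Mapping.keys v \<subseteq> monomials m w"
proof
  have "subspace {v :: mono \<Rightarrow>\<^sub>0 real. Poly_Mapping.keys v \<subseteq> monomials m w}"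
    unfolding subspace_def
    by (auto simp: subset_iff in_keys_iff lookup_add lookup_scaleR)
      (metis add.right_neutral)
  then have "span (unit ` monomials m w) \<subseteq> {v. Poly_Mapping.keys v \<subseteq> monomials m w}"
    by (rule span_minimal[rotated]) auto
  then show "v \<in> weight_space m w \<Longrightarrow> Poly_Mapping.keys v \<subseteq> monomials m w"
    unfolding weight_space_def by blast
qed (simp add: weight_space_def span_units)

lemma finite_monomials: "finite (monomials m w)"
proof -
  let ?B = "UNIV :: bool set" and ?N = "{..w}"
  have "monomials m w \<subseteq> (\<lambda>(a1, a2, a3, e, p, q, r). Mon a1 a2 a3 e p q r) `
      (?B \<times> ?B \<times> ?B \<times> ?B \<times> ?N \<times> ?N \<times> ?N)"
  proof
    fix k assume "k \<in> monomials m w"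
    then show "k \<in> (\<lambda>(a1, a2, a3, e, p, q, r). Mon a1 a2 a3 e p q r) `
        (?B \<times> ?B \<times> ?B \<times> ?B \<times> ?N \<times> ?N \<times> ?N)"
      by (cases k) (auto simp: monomials_def image_iff)
  qed
  then show ?thesis by (rule finite_subset) simp
qed

lemma dim_subspace_weight_space:
  assumes K: "subspace K" "K \<subseteq> weight_space m w" and J: "J \<subseteq> monomials m w"
    and inj: "\<And>x. x \<in> K \<Longrightarrow> (\<And>j. j \<in> J \<Longrightarrow> Poly_Mapping.lookup x j = 0) \<Longrightarrow> x = 0"
    and surj: "\<And>j. j \<in> J \<Longrightarrow>
      \<exists>x\<in>K. \<forall>i\<in>J. Poly_Mapping.lookup x i = (if i = j then 1 else 0)"
  shows "dim K = card J"
  by (rule dim_eq_card_coordinates[where co = "\<lambda>k x. Poly_Mapping.lookup x k"])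
    (use assms finite_subset[OF J finite_monomials] linear_lookup in auto)

lemma dim_weight_space: "dim (weight_space m w) = card (monomials m w)"
proof (rule dim_subspace_weight_space[OF subspace_weight_space])
  fix x assume x: "x \<in> weight_space m w" "\<And>j. j \<in> monomials m w \<Longrightarrow> Poly_Mapping.lookup x j = 0"
  show "x = 0"
    by (rule poly_mapping_eqI) (use x in \<open>auto simp: in_weight_space_iff in_keys_iff\<close>)
next
  fix j assume "j \<in> monomials m w"
  then show "\<exists>x\<in>weight_space m w. \<forall>i\<in>monomials m w. Poly_Mapping.lookup x i = (if i = j then 1 else 0)"
    by (intro bexI[of _ "unit j"]) (auto simp: in_weight_space_iff lookup_single when_def)
qed auto

lemma unit_in_weight_space: "deg k = m \<Longrightarrow> wt k = w \<Longrightarrow> unit k \<in> weight_space m w"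
  by (simp add: in_weight_space_iff monomials_def)

lemma linear_in_weight_space:
  assumes "linear f" "\<And>k. k \<in> monomials m w \<Longrightarrow> f (unit k) \<in> weight_space m' w'" "v \<in> weight_space m w"
  shows "f v \<in> weight_space m' w'"
proof -
  have "f v \<in> span (f ` unit ` monomials m w)"
    using assms(3) linear_span_image[OF assms(1)] unfolding weight_space_def by blast
  also have "\<dots> \<subseteq> weight_space m' w'"
    by (rule span_minimal[OF _ subspace_weight_space]) (use assms(2) in auto)
  finally show ?thesis .
qed

lemmas weight_space_closed = subspace_0[OF subspace_weight_space] subspace_add[OF subspace_weight_space]
  subspace_diff[OF subspace_weight_space] subspace_neg[OF subspace_weight_space] subspace_scale[OF subspace_weight_space]

lemma lmul_weight_space: "v \<in> weight_space m w \<Longrightarrow> lmul g v \<in> weight_space (Suc m) (w + gr g)"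
proof (rule linear_in_weight_space[OF linear_lmul])
  fix k assume "k \<in> monomials m w"
  then show "lmul g (unit k) \<in> weight_space (Suc m) (w + gr g)"
    by (cases k; cases g) (auto simp: lmul_unit monomials_def intro!: weight_space_closed unit_in_weight_space)
qed

lemma bd_weight_space: "v \<in> weight_space (Suc m) w \<Longrightarrow> bd v \<in> weight_space m w"
proof (rule linear_in_weight_space[OF linear_bd])
  fix k assume k: "k \<in> monomials (Suc m) w"
  obtain a1 a2 a3 e p q r where "k = Mon a1 a2 a3 e p q r" by (cases k)
  with k show "bd (unit k) \<in> weight_space m w"
    by (cases r rule: nat_cases_upto_1)
      (auto simp: bd_unit monomials_def intro!: weight_space_closed unit_in_weight_space)
qed

lemma bd_image_weight_space_subset_cycle_space: "bd ` weight_space (Suc m) w \<subseteq> cycle_space m w"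
  by (auto simp: cycle_space_def bd_weight_space bd_bd)

lemma dim_weight_space_rank_nullity: "card (monomials m w) = dim (cycle_space m w) + dim (bd ` weight_space m w)"
  unfolding dim_weight_space[symmetric] cycle_space_def
  by (rule rank_nullity[OF linear_bd subspace_weight_space, of _ _ "unit ` monomials m w"])
    (simp_all add: weight_space_def finite_monomials)

context heisenberg
begin

lemma Lmul_weight_space: "Y \<in> grade y \<Longrightarrow> v \<in> weight_space m w \<Longrightarrow> Lmul Y v \<in> weight_space (Suc m) (w + y)"
proof -
  assume Y: "Y \<in> grade y" and v: "v \<in> weight_space m w"
  have "Lmul Y v \<in> span ((\<lambda>Y. Lmul Y v) ` E ` {g. gr g = y})"
    using Y linear_span_image[OF linear_Lmul_left] unfolding grade_eq by blast
  also have "\<dots> \<subseteq> weight_space (Suc m) (w + y)"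
    by (rule span_minimal[OF _ subspace_weight_space]) (use lmul_weight_space[OF v] in \<open>auto simp: Lmul_E\<close>)
  finally show ?thesis .
qed

lemma normal_weight_space: "homogeneous Ys ys \<Longrightarrow> normal Ys \<in> weight_space (length Ys) (sum_list ys)"
  unfolding homogeneous_def
proof (induction rule: list_all2_induct)
  case Nil
  show ?case by (simp add: normal_def unit_in_weight_space)
next
  case (Cons Y Ys y ys)
  then show ?case using Lmul_weight_space[of Y y "normal Ys" "length Ys" "sum_list ys"]
    by (simp add: normal_def add.commute[of y])
qed

lemma weight_chains_eq: "weight_chains m w = \<Psi> ` weight_space m w"
proof
  show "weight_chains m w \<subseteq> \<Psi> ` weight_space m w"
    unfolding weight_chains_def
  proof (rule span_minimal[OF _ linear_subspace_image[OF linear_\<Psi> subspace_weight_space]], rule subsetI)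
    fix c :: "'a chain"
    assume "c \<in> {chain_prod Ys |Ys ys. homogeneous Ys ys \<and> length Ys = m \<and> sum_list ys = w}"
    then obtain Ys ys where "c = chain_prod Ys" "homogeneous Ys ys" "length Ys = m" "sum_list ys = w"
      by blast
    then show "c \<in> \<Psi> ` weight_space m w"
      using normal_weight_space[of Ys ys] by (intro image_eqI[of _ _ "normal Ys"]) (simp_all add: \<Psi>_normal)
  qed
next
  have "\<Psi> v \<in> weight_chains m w" if "v \<in> weight_space m w" for v
  proof -
    have "\<Psi> v \<in> span (\<Psi> ` unit ` monomials m w)"
      using that linear_span_image[OF linear_\<Psi>] unfolding weight_space_def by blast
    also have "\<dots> \<subseteq> weight_chains m w"
      unfolding weight_chains_def
    proof (rule span_mono, rule subsetI)
      fix c assume "c \<in> \<Psi> ` unit ` monomials m w"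
      then obtain k where k: "k \<in> monomials m w" "c = \<mu> k" by (auto simp: \<Psi>_unit)
      have "length (mono_word k) = m" "sum_list (map gr (mono_word k)) = w"
        using k(1) by (cases k; simp add: monomials_def sum_list_replicate)+
      then show "c \<in> {chain_prod Ys |Ys ys. homogeneous Ys ys \<and> length Ys = m \<and> sum_list ys = w}"
        using homogeneous_map_E[of "mono_word k"] k(2)
        by (intro CollectI exI[of _ "map E (mono_word k)"] exI[of _ "map gr (mono_word k)"])
          (simp add: \<mu>_eq_chain_prod)
    qed
    finally show ?thesis .
  qed
  then show "\<Psi> ` weight_space m w \<subseteq> weight_chains m w" by blast
qed

lemma inj_\<Psi>: "inj \<Psi>"
  by (rule inj_on_inverseI[of _ \<Phi>]) (rule \<Phi>_\<Psi>)

lemma bdry_\<Psi>: "bdry (\<Psi> v) = \<Psi> (bd v)"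
  by (simp add: bdry_def \<Phi>_\<Psi>)

lemma weight_cycles_eq: "weight_cycles br m w = \<Psi> ` cycle_space m w"
proof -
  have 0: "\<Psi> v = 0 \<longleftrightarrow> v = 0" for v
    using inj_eq[OF inj_\<Psi>, of v 0] by (simp add: linear_0[OF linear_\<Psi>])
  have "weight_cycles br m w = \<Psi> ` {v \<in> weight_space m w. bdry (\<Psi> v) = 0}"
    unfolding weight_cycles_def weight_chains_eq boundary_eq by blast
  also have "{v \<in> weight_space m w. bdry (\<Psi> v) = 0} = cycle_space m w"
    by (simp only: bdry_\<Psi> 0 cycle_space_def)
  finally show ?thesis .
qed

lemma dim_weight_chains: "dim (weight_chains m w :: 'a chain set) = card (monomials m w)"
  by (simp add: weight_chains_eq dim_linear_inj_image[OF linear_\<Psi> inj_\<Psi> subspace_weight_space] dim_weight_space)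

lemma dim_weight_cycles: "dim (weight_cycles br m w) = dim (cycle_space m w)"
  by (simp add: weight_cycles_eq dim_linear_inj_image[OF linear_\<Psi> inj_\<Psi> subspace_cycle_space])

text \<open>The rank of the boundary on \<open>m + 1\<close>-chains is determined by its nullity, so the Betti numbers follow
  from the numbers of monomials and the dimensions of the spaces of cycles. That \<^const>\<open>bd\<close> squares to 0
  enters because the boundaries have to be a subspace of the cycles.\<close>

lemma betti_eq: "int (betti br m w) =
    int (dim (cycle_space m w)) + int (dim (cycle_space (Suc m) w)) - int (card (monomials (Suc m) w))"
proof -
  let ?I = "bd ` weight_space (Suc m) w"
  have I: "subspace ?I" by (rule linear_subspace_image[OF linear_bd subspace_weight_space])
  have im: "boundary br ` weight_chains (m + 1) w = \<Psi> ` ?I"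
    by (simp add: boundary_eq weight_chains_eq image_image bdry_\<Psi>)
  have sp: "\<Psi> ` cycle_space m w \<subseteq> span (\<Psi> ` unit ` monomials m w)"
    using linear_span_image[OF linear_\<Psi>] unfolding cycle_space_def weight_space_def by blast
  note args = linear_subspace_image[OF linear_\<Psi> subspace_cycle_space] sp
    finite_imageI[OF finite_imageI[OF finite_monomials]] linear_subspace_image[OF linear_\<Psi> I]
    image_mono[OF bd_image_weight_space_subset_cycle_space]
  have "betti br m w = dim (\<Psi> ` cycle_space m w) - dim (\<Psi> ` ?I)"
    unfolding betti_def im weight_cycles_eq by (rule quotient_dim_eq[OF args])
  moreover have "dim (\<Psi> ` ?I) \<le> dim (\<Psi> ` cycle_space m w)"
  proof -
    obtain C where "quotient_basis (\<Psi> ` cycle_space m w) (\<Psi> ` ?I) C"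
      using quotient_basis_exists[OF args(1,4,5)] .
    then show ?thesis by (rule card_quotient_basis(2)[OF args])
  qed
  ultimately show ?thesis
    using dim_weight_space_rank_nullity[of "Suc m" w]
    by (simp add: dim_linear_inj_image[OF linear_\<Psi> inj_\<Psi> subspace_cycle_space]
        dim_linear_inj_image[OF linear_\<Psi> inj_\<Psi> I])
qed

end

section \<open>Counting monomials\<close>

text \<open>Exponents \<open>(p, q, r)\<close> of the \<open>U\<close>-factors in weight \<open>n\<close>, for monomials without \<open>V\<close>; with the factor \<open>V\<close>,
  which has weight 2, the exponents range over the set \<open>tri2 n\<close>.\<close>

definition tri :: "nat \<Rightarrow> (nat \<times> nat \<times> nat) set" where
  "tri n = {(p, q, r). p + q + r = n}"

definition tri2 :: "nat \<Rightarrow> (nat \<times> nat \<times> nat) set" where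
  "tri2 n = {(p, q, r). p + q + r + 2 = n}"

definition slice :: "nat \<Rightarrow> nat \<Rightarrow> (nat \<times> nat \<times> nat) set" where
  "slice n c = {(p, q, r). p + q + r = n \<and> r = c}"

lemma finite_tri: "finite (tri n)"
  by (rule finite_subset[of _ "{..n} \<times> {..n} \<times> {..n}"]) (auto simp: tri_def)

lemma finite_slice: "finite (slice n c)"
  by (rule finite_subset[OF _ finite_tri[of n]]) (auto simp: tri_def slice_def)

lemma card_slice: "c \<le> n \<Longrightarrow> card (slice n c) = Suc (n - c)"
proof -
  assume "c \<le> n"
  then have "slice n c = (\<lambda>p. (p, n - c - p, c)) ` {..n - c}"
    by (auto simp: slice_def image_iff)
  then show ?thesis by (simp add: card_image inj_on_def)
qed

lemma card_tri: "card (tri n) = (n + 2) choose 2"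
proof (induction n)
  case 0
  have "tri 0 = {(0, 0, 0)}" by (auto simp: tri_def)
  then show ?case by (simp add: numeral_2_eq_2)
next
  case (Suc n)
  let ?up = "\<lambda>(p, q, r). (p, q, Suc r)"
  have "tri (Suc n) = slice (Suc n) 0 \<union> ?up ` tri n"
  proof (rule set_eqI, clarify)
    fix p q r
    show "(p, q, r) \<in> tri (Suc n) \<longleftrightarrow> (p, q, r) \<in> slice (Suc n) 0 \<union> ?up ` tri n"
      by (cases r) (auto simp: tri_def slice_def image_iff)
  qed
  moreover have "slice (Suc n) 0 \<inter> ?up ` tri n = {}" by (auto simp: slice_def)
  moreover have "card (?up ` tri n) = card (tri n)" by (rule card_image) (auto simp: inj_on_def)
  ultimately have "card (tri (Suc n)) = card (slice (Suc n) 0) + card (tri n)"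
    by (simp add: card_Un_disjoint finite_slice finite_tri)
  then show ?case by (simp add: Suc card_slice numeral_2_eq_2)
qed

lemma card_tri2: "card (tri2 n) = n choose 2"
proof (cases "n \<ge> 2")
  case True
  then obtain k where k: "n = k + 2" using le_Suc_ex[of 2 n] by (auto simp: add.commute)
  then have "tri2 n = tri k" by (auto simp: tri2_def tri_def)
  then show ?thesis by (simp add: k card_tri)
next
  case False
  then have "tri2 n = {}" by (auto simp: tri2_def)
  with False show ?thesis by (simp add: binomial_eq_0)
qed

lemma finite_tri2: "finite (tri2 n)"
  by (rule finite_subset[of _ "{..n} \<times> {..n} \<times> {..n}"]) (auto simp: tri2_def)

definition low :: "nat \<Rightarrow> (nat \<times> nat \<times> nat) set" where
  "low n = {(p, q, r). p + q + r = n \<and> r \<le> 1}"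

definition low1 :: "nat \<Rightarrow> (nat \<times> nat \<times> nat) set" where
  "low1 n = {(p, q, r). p + q + r = n \<and> (r = 0 \<or> r = 1 \<and> p > 0)}"

lemma low_eq: "low n = slice n 0 \<union> slice n 1" and low1_eq: "low1 n = low n - {(0, n - 1, 1)}"
  by (auto simp: low_def low1_def slice_def)

lemma finite_low: "finite (low n)"
  by (simp add: low_eq finite_slice)

lemma card_low: "n > 0 \<Longrightarrow> card (low n) = 2 * n + 1"
  unfolding low_eq
  by (subst card_Un_disjoint) (auto simp: finite_slice card_slice, auto simp: slice_def)

lemma card_low1: "n > 0 \<Longrightarrow> card (low1 n) = 2 * n"
  using card_low[of n] card_Diff_singleton[of "(0, n - 1, 1)" "low n"]
  by (simp add: low1_eq) (simp add: low_def)

lemma finite_low1: "finite (low1 n)"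
  by (simp add: low1_eq finite_low)

definition block :: "bool \<Rightarrow> bool \<Rightarrow> bool \<Rightarrow> bool \<Rightarrow> (nat \<times> nat \<times> nat) set \<Rightarrow> mono set" where
  "block a1 a2 a3 e A = (\<lambda>(p, q, r). Mon a1 a2 a3 e p q r) ` A"

lemma in_block [simp]:
  "Mon b1 b2 b3 f p q r \<in> block a1 a2 a3 e A \<longleftrightarrow>
     b1 = a1 \<and> b2 = a2 \<and> b3 = a3 \<and> f = e \<and> (p, q, r) \<in> A"
  by (force simp: block_def)

lemma card_block: "card (block a1 a2 a3 e A) = card A"
  unfolding block_def by (rule card_image) (auto simp: inj_on_def)

lemma finite_block: "finite A \<Longrightarrow> finite (block a1 a2 a3 e A)"
  by (simp add: block_def)

lemma block_disjoint:
  "(a1, a2, a3, e) \<noteq> (b1, b2, b3, f) \<Longrightarrow> block a1 a2 a3 e A \<inter> block b1 b2 b3 f A' = {}"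
  by (auto simp: block_def)

lemmas card_blocks = card_Un_disjoint Int_Un_distrib2 block_disjoint finite_block card_block
  finite_tri finite_tri2 finite_slice finite_low finite_low1

lemma mono_set_eqI:
  "(\<And>a1 a2 a3 e p q r. Mon a1 a2 a3 e p q r \<in> A \<longleftrightarrow> Mon a1 a2 a3 e p q r \<in> A') \<Longrightarrow> A = A'"
  by (metis mono.exhaust set_eqI)

text \<open>The weight is the \<open>U\<close>-degree plus twice the number of factors \<open>V\<close>. Subtracting it from the length leaves
  the number of \<open>Z\<close>-factors minus the number of factors \<open>V\<close>, which lies between \<open>-1\<close> and \<open>3\<close>.\<close>

lemma monomials_eq:
  "w > 0 \<Longrightarrow> monomials (w - 1) w = block False False False True (tri2 w)"
  "monomials w w = block False False False False (tri w) \<union> block True False False True (tri2 w)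
     \<union> block False True False True (tri2 w) \<union> block False False True True (tri2 w)"
  "monomials (w + 1) w = block True False False False (tri w) \<union> block False True False False (tri w)
     \<union> block False False True False (tri w) \<union> block True True False True (tri2 w)
     \<union> block True False True True (tri2 w) \<union> block False True True True (tri2 w)"
  "monomials (w + 2) w = block True True False False (tri w) \<union> block True False True False (tri w)
     \<union> block False True True False (tri w) \<union> block True True True True (tri2 w)"
  "monomials (w + 3) w = block True True True False (tri w)"
  "monomials (w + 4) w = {}"
  by (rule mono_set_eqI, rename_tac a1 a2 a3 e p q r, case_tac a1; case_tac a2; case_tac a3;
      case_tac e; simp add: monomials_def tri_def tri2_def; linarith)+

lemma card_monomials:
  "w > 0 \<Longrightarrow> card (monomials (w - 1) w) = w choose 2"
  "card (monomials w w) = 3 * (w choose 2) + ((w + 2) choose 2)"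
  "card (monomials (w + 1) w) = 3 * (w choose 2) + 3 * ((w + 2) choose 2)"
  "card (monomials (w + 2) w) = (w choose 2) + 3 * ((w + 2) choose 2)"
  "card (monomials (w + 3) w) = (w + 2) choose 2"
  "card (monomials (w + 4) w) = 0"
  by (simp_all only: monomials_eq) (simp_all add: card_blocks card_tri card_tri2)

section \<open>Cycles\<close>

text \<open>The transposed boundary: which coefficients of \<open>x\<close> contribute to a given coefficient of its
  boundary. It turns the equation for cycles into equations between coefficients.\<close>

lemma lookup_bd:
  "Poly_Mapping.lookup (bd x) (Mon a1 a2 a3 e p q r) =
     (if \<not> a1 \<and> \<not> a2 \<and> a3 then Poly_Mapping.lookup x (Mon True True False e p q r) else 0)
   + (if \<not> a1 \<and> q > 0 then
        real (Suc r) * Poly_Mapping.lookup x (Mon True a2 a3 e p (q - 1) (Suc r)) else 0)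
   + (if \<not> a2 \<and> p > 0 then
        sg a1 * real (Suc r) * Poly_Mapping.lookup x (Mon a1 True a3 e (p - 1) q (Suc r)) else 0)
   + (if e then sg a1 * sg a2 * sg a3 * (real (Suc (Suc r)) * real (Suc r)) *
        Poly_Mapping.lookup x (Mon a1 a2 a3 False p q (Suc (Suc r))) else 0)" (is "_ = ?R x")
proof -
  have L: "linear (\<lambda>x. Poly_Mapping.lookup (bd x) (Mon a1 a2 a3 e p q r))"
    by (rule linearI) (simp_all add: bd_linear lookup_add lookup_scaleR)
  have R: "linear ?R"
    by (rule linearI) (simp_all add: lookup_add lookup_scaleR algebra_simps)
  show ?thesis
  proof (rule linear_eq_on_units[OF L R])
    fix m
    obtain b1 b2 b3 f s t u where m: "m = Mon b1 b2 b3 f s t u" by (cases m)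
    have 1: "Poly_Mapping.lookup (if b1 \<and> b2 \<and> \<not> b3 then unit (Mon False False True f s t u) else 0)
        (Mon a1 a2 a3 e p q r) =
      (if \<not> a1 \<and> \<not> a2 \<and> a3 then Poly_Mapping.lookup (unit m) (Mon True True False e p q r) else 0)"
      by (auto simp: m lookup_single when_def)
    have 2: "Poly_Mapping.lookup
        (if b1 then real u *\<^sub>R unit (Mon False b2 b3 f s (Suc t) (u - 1)) else 0)
        (Mon a1 a2 a3 e p q r) =
      (if \<not> a1 \<and> q > 0 then
        real (Suc r) * Poly_Mapping.lookup (unit m) (Mon True a2 a3 e p (q - 1) (Suc r)) else 0)"
      by (cases q; cases u) (auto simp: m lookup_single lookup_scaleR when_def)
    have 3: "Poly_Mapping.lookup
        (if b2 then (sg b1 * real u) *\<^sub>R unit (Mon b1 False b3 f (Suc s) t (u - 1)) else 0)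
        (Mon a1 a2 a3 e p q r) =
      (if \<not> a2 \<and> p > 0 then
        sg a1 * real (Suc r) * Poly_Mapping.lookup (unit m) (Mon a1 True a3 e (p - 1) q (Suc r)) else 0)"
      by (cases p; cases u) (auto simp: m lookup_single lookup_scaleR when_def)
    have 4: "Poly_Mapping.lookup
        (if f then 0 else (sg b1 * sg b2 * sg b3 * (real u * (real u - 1))) *\<^sub>R
          unit (Mon b1 b2 b3 True s t (u - 2))) (Mon a1 a2 a3 e p q r) =
      (if e then sg a1 * sg a2 * sg a3 * (real (Suc (Suc r)) * real (Suc r)) *
        Poly_Mapping.lookup (unit m) (Mon a1 a2 a3 False p q (Suc (Suc r))) else 0)"
      by (rule nat_cases_upto_1[of u])
        (auto simp: m lookup_single lookup_scaleR when_def)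
    show "Poly_Mapping.lookup (bd (unit m)) (Mon a1 a2 a3 e p q r) = ?R (unit m)"
      unfolding bd_unit using 1 2 3 4 by (simp only: m bd_mono.simps lookup_add)
  qed
qed

abbreviation lk :: "(mono \<Rightarrow>\<^sub>0 real) \<Rightarrow> mono \<Rightarrow> real" where
  "lk \<equiv> Poly_Mapping.lookup"

lemma lookup_bd_cycle: "x \<in> cycle_space m w \<Longrightarrow> lk (bd x) k = 0"
  by (simp add: cycle_space_def)

lemma lookup_cycle_outside: "x \<in> cycle_space m w \<Longrightarrow> k \<notin> monomials m w \<Longrightarrow> lk x k = 0"
  by (auto simp: cycle_space_def in_weight_space_iff in_keys_iff)

text \<open>In each length a set \<open>J\<close> of monomials is found whose coefficients parametrise the cycles: they
  determine a cycle, and each of them can be made 1 and the others 0. The first condition follows by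
  solving the equations of \<open>lookup_bd\<close>, the second from explicit cycles, in which a monomial from
  \<open>J\<close> is corrected by monomials outside \<open>J\<close>.\<close>

lemma dim_cycle_space_eq_card:
  assumes J: "J \<subseteq> monomials m w"
    and inj: "\<And>x. x \<in> cycle_space m w \<Longrightarrow> (\<And>j. j \<in> J \<Longrightarrow> lk x j = 0) \<Longrightarrow>
      (\<And>k. k \<in> monomials m w \<Longrightarrow> lk x k = 0)"
    and surj: "\<And>j. j \<in> J \<Longrightarrow>
      \<exists>x. x \<in> weight_space m w \<and> bd x = 0 \<and> (\<forall>i\<in>J. lk x i = (if i = j then 1 else 0))"
  shows "dim (cycle_space m w) = card J"
proof (rule dim_subspace_weight_space[OF subspace_cycle_space _ J])
  fix x assume x: "x \<in> cycle_space m w" "\<And>j. j \<in> J \<Longrightarrow> lk x j = 0"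
  show "x = 0"
  proof (rule poly_mapping_eqI)
    fix k show "lk x k = lk 0 k"
      using inj[OF x, of k] lookup_cycle_outside[OF x(1), of k] by auto
  qed
next
  fix j assume "j \<in> J"
  then show "\<exists>x\<in>cycle_space m w. \<forall>i\<in>J. lk x i = (if i = j then 1 else 0)"
    using surj[of j] by (auto simp: cycle_space_def)
qed (auto simp: cycle_space_def)

text \<open>With all three \<open>Z\<close>-factors, \<open>[Z1, U3] = U2\<close> alone detects every monomial that contains \<open>U3\<close>.\<close>

lemma dim_cycle_space_3: "dim (cycle_space (w + 3) w) = w + 1"
proof -
  let ?J = "block True True True False (slice w 0)"
  have "dim (cycle_space (w + 3) w) = card ?J"
  proof (rule dim_cycle_space_eq_card)
    show "?J \<subseteq> monomials (w + 3) w"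
      by (auto simp: block_def monomials_def slice_def)
  next
    fix x k assume x: "x \<in> cycle_space (w + 3) w" and J: "\<And>j. j \<in> ?J \<Longrightarrow> lk x j = 0"
      and k: "k \<in> monomials (w + 3) w"
    have "lk x (Mon True True True False p q r) = 0" if "p + q + r = w" for p q r
    proof (cases r)
      case 0
      then show ?thesis using J[of "Mon True True True False p q r"] that by (simp add: slice_def)
    next
      case (Suc r')
      then show ?thesis
        using lookup_bd_cycle[OF x, of "Mon False True True False p (Suc q) r'"]
        by (simp add: lookup_bd)
    qed
    with k show "lk x k = 0"
      unfolding monomials_eq by (cases k) (simp add: tri_def)
  next
    fix j assume "j \<in> ?J"
    then obtain p q where j: "j = Mon True True True False p q 0" "p + q = w"
      by (auto simp: block_def slice_def)
    then show "\<exists>x. x \<in> weight_space (w + 3) w \<and> bd x = 0 \<and> (\<forall>i\<in>?J. lk x i = (if i = j then 1 else 0))"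
      by (intro exI[of _ "unit j"])
        (auto simp: bd_unit lookup_single when_def intro!: unit_in_weight_space)
  qed
  then show ?thesis by (simp add: card_block card_slice)
qed

text \<open>The coefficients of \<open>Z1 Z2 Z3 V\<close> are free, and so are those of \<open>Z1 Z3\<close> and \<open>Z2 Z3\<close> with at most one
  factor \<open>U3\<close>. The contraction of \<open>U3 U3\<close> to \<open>V\<close> expresses those
  with more factors \<open>U3\<close> through the former, and the contraction of \<open>Z1 Z2\<close> to \<open>Z3\<close>
  then determines the coefficients of \<open>Z1 Z2\<close>.\<close>

lemma dim_cycle_space_2:
  assumes "w > 0"
  shows "dim (cycle_space (w + 2) w) = (w choose 2) + 2 * (2 * w + 1)"
proof -
  let ?J = "block True True True True (tri2 w) \<union> block True False True False (low w)
    \<union> block False True True False (low w)"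
  have "dim (cycle_space (w + 2) w) = card ?J"
  proof (rule dim_cycle_space_eq_card)
    show "?J \<subseteq> monomials (w + 2) w"
      by (auto simp: block_def monomials_def tri2_def low_def)
  next
    fix x k assume x: "x \<in> cycle_space (w + 2) w" and J: "\<And>j. j \<in> ?J \<Longrightarrow> lk x j = 0"
      and k: "k \<in> monomials (w + 2) w"
    note eq = lookup_bd_cycle[OF x]
    have out: "lk x (Mon a1 a2 a3 e p q r) = 0"
      if "\<not> (of_bool a1 + of_bool a2 + of_bool a3 = 2 + of_bool e + (0::nat) \<and> p + q + r + 2 * of_bool e = w)"
      for a1 a2 a3 e p q r
      using lookup_cycle_outside[OF x] that by (auto simp: monomials_def)
    have 1: "lk x (Mon True True True True p q r) = 0" for p q r
      using J[of "Mon True True True True p q r"] out[of True True True True p q r]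
      by (auto simp: tri2_def)
    have 2: "lk x (Mon True False True False p q r) = 0" for p q r
    proof (cases "r \<le> 1")
      case True
      then show ?thesis
        using J[of "Mon True False True False p q r"] out[of True False True False p q r]
        by (auto simp: low_def)
    next
      case False
      then obtain s where "r = Suc (Suc s)" by (cases r rule: nat_cases_upto_1) auto
      then show ?thesis using eq[of "Mon True False True True p q s"] by (auto simp: lookup_bd 1 simp del: of_nat_Suc split: if_splits)
    qed
    have 3: "lk x (Mon False True True False p q r) = 0" for p q r
    proof (cases "r \<le> 1")
      case True
      then show ?thesis
        using J[of "Mon False True True False p q r"] out[of False True True False p q r]
        by (auto simp: low_def)
    next
      case False
      then obtain s where "r = Suc (Suc s)" by (cases r rule: nat_cases_upto_1) auto
      then show ?thesis using eq[of "Mon False True True True p q s"] by (auto simp: lookup_bd 1 simp del: of_nat_Suc split: if_splits)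
    qed
    have 4: "lk x (Mon True True False False p q r) = 0" for p q r
      using eq[of "Mon False False True False p q r"] by (auto simp: lookup_bd 2 3 split: if_splits)
    show "lk x k = 0"
      using k 1 2 3 4 unfolding monomials_eq by (cases k) auto
  next
    fix j assume "j \<in> ?J"
    then consider p q r where "j = Mon True True True True p q r" "p + q + r + 2 = w"
      | p q r where "j = Mon True False True False p q r" "p + q + r = w" "r \<le> 1"
      | p q r where "j = Mon False True True False p q r" "p + q + r = w" "r \<le> 1"
      by (auto simp: block_def tri2_def low_def)
    then show "\<exists>x. x \<in> weight_space (w + 2) w \<and> bd x = 0 \<and> (\<forall>i\<in>?J. lk x i = (if i = j then 1 else 0))"
    proof cases
      case (1 p q r)
      show ?thesis
      proof (cases r)
        case 0
        with 1 show ?thesis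
          by (intro exI[of _ "unit j"])
            (auto simp: bd_unit lookup_single when_def intro!: unit_in_weight_space)
      next
        case (Suc s)
        \<comment> \<open>The corrections remove the \<open>V\<close>-terms; the terms in \<open>Z3\<close> that they create cancel each other.
          For \<open>r = 0\<close> they would belong to \<open>J\<close>, but then the monomial is itself a cycle.\<close>
        define y where "y = (real r + 1) *\<^sub>R unit j
            + (unit (Mon True False True False (Suc p) q (Suc r))
               - unit (Mon False True True False p (Suc q) (Suc r)))"
        have "bd y = 0"
          by (simp add: y_def 1 Suc bd_unit bd_linear algebra_simps scaleR_numeral_expand)
        moreover have "y \<in> weight_space (w + 2) w"
          using 1 by (auto simp: y_def intro!: weight_space_closed unit_in_weight_space)
        moreover have "\<forall>i\<in>?J. lk y i = (if i = j then real r + 1 else 0)"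
          using 1 Suc by (auto simp: y_def lookup_add lookup_minus lookup_scaleR lookup_single
              when_def block_def low_def tri2_def)
        ultimately show ?thesis
          by (intro exI[of _ "(1 / (real r + 1)) *\<^sub>R y"])
            (auto simp: bd_linear lookup_scaleR intro!: weight_space_closed)
      qed
    next
      case (2 p q r)
      then show ?thesis
        by (intro exI[of _ "unit j - real r *\<^sub>R unit (Mon True True False False p (Suc q) 0)"];
            cases r)
          (auto simp: bd_unit bd_linear lookup_add lookup_minus lookup_scaleR lookup_single when_def
              block_def low_def tri2_def intro!: weight_space_closed unit_in_weight_space)
    next
      case (3 p q r)
      then show ?thesis
        by (intro exI[of _ "unit j - real r *\<^sub>R unit (Mon True True False False (Suc p) q 0)"];
            cases r)
          (auto simp: bd_unit bd_linear lookup_add lookup_minus lookup_scaleR lookup_single when_def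
              block_def low_def tri2_def intro!: weight_space_closed unit_in_weight_space)
    qed
  qed
  then show ?thesis by (simp add: card_blocks card_tri2 card_low assms)
qed

text \<open>The coefficients of \<open>Z3\<close>, \<open>Z1 Z3 V\<close> and \<open>Z2 Z3 V\<close> are free and determine those of \<open>Z1 Z2 V\<close> by the
  contraction to \<open>Z3 V\<close>. The contraction of \<open>U3 U3\<close> leaves free the coefficients of \<open>Z1\<close> and \<open>Z2\<close> with at most
  one factor \<open>U3\<close>. Among those with exactly one, \<open>[Z1, U3] = U2\<close> and \<open>[Z2, U3] = U1\<close> impose a divisibility
  relation: the part of \<open>Z1\<close> is a multiple of \<open>U1\<close> and determines the part of \<open>Z2\<close>.\<close>

lemma dim_cycle_space_1:
  assumes "w > 0"
  shows "dim (cycle_space (w + 1) w) = ((w + 2) choose 2) + 2 * (w choose 2) + (3 * w + 1)"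
proof -
  let ?J = "block False False True False (tri w) \<union> block True False True True (tri2 w)
    \<union> block False True True True (tri2 w) \<union> block True False False False (low1 w)
    \<union> block False True False False (slice w 0)"
  have "dim (cycle_space (w + 1) w) = card ?J"
  proof (rule dim_cycle_space_eq_card)
    show "?J \<subseteq> monomials (w + 1) w"
      by (auto simp: block_def monomials_def tri_def tri2_def low1_def slice_def)
  next
    fix x k assume x: "x \<in> cycle_space (w + 1) w" and J: "\<And>j. j \<in> ?J \<Longrightarrow> lk x j = 0"
      and k: "k \<in> monomials (w + 1) w"
    note eq = lookup_bd_cycle[OF x]
    have out: "lk x (Mon a1 a2 a3 e p q r) = 0"
      if "\<not> (of_bool a1 + of_bool a2 + of_bool a3 = 1 + of_bool e + (0::nat) \<and> p + q + r + 2 * of_bool e = w)"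
      for a1 a2 a3 e p q r
      using lookup_cycle_outside[OF x] that by (auto simp: monomials_def)
    have 1: "lk x (Mon False False True False p q r) = 0"
      "lk x (Mon True False True True p q r) = 0"
      "lk x (Mon False True True True p q r) = 0" for p q r
      using J[of "Mon False False True False p q r"] out[of False False True False p q r]
        J[of "Mon True False True True p q r"] out[of True False True True p q r]
        J[of "Mon False True True True p q r"] out[of False True True True p q r]
      by (auto simp: tri_def tri2_def)
    have 2: "lk x (Mon True True False True p q r) = 0" for p q r
      using eq[of "Mon False False True True p q r"] by (auto simp: lookup_bd 1 split: if_splits)
    have 3: "lk x (Mon True False False False p q r) = 0" if "r \<noteq> 1 \<or> p > 0" for p q r
    proof (cases "r \<le> 1")
      case True
      then show ?thesis
        using J[of "Mon True False False False p q r"] out[of True False False False p q r] that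
        by (cases "p + q + r = w"; cases "r = 0") (auto simp: low1_def)
    next
      case False
      then obtain s where "r = Suc (Suc s)" by (cases r rule: nat_cases_upto_1) auto
      then show ?thesis using eq[of "Mon True False False True p q s"]
        by (auto simp: lookup_bd 2 simp del: of_nat_Suc split: if_splits)
    qed
    \<comment> \<open>Without the factor \<open>U1\<close>, the bracket \<open>[Z2, U3] = U1\<close> cannot compensate \<open>[Z1, U3] = U2\<close>.\<close>
    have 4: "lk x (Mon True False False False 0 q 1) = 0" for q
      using eq[of "Mon False False False False 0 (Suc q) 0"] by (auto simp: lookup_bd)
    have 5: "lk x (Mon True False False False p q r) = 0" for p q r
      using 3[of r p q] 4[of q] by (cases "p = 0") auto
    have 6: "lk x (Mon False True False False p q r) = 0" for p q r
    proof (rule nat_cases_upto_1[of r])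
      assume "r = 0"
      then show ?thesis
        using J[of "Mon False True False False p q r"] out[of False True False False p q r]
        by (auto simp: slice_def)
    next
      assume "r = 1"
      then show ?thesis using eq[of "Mon False False False False (Suc p) q 0"]
        by (auto simp: lookup_bd 5 split: if_splits)
    next
      fix s assume "r = Suc (Suc s)"
      then show ?thesis using eq[of "Mon False True False True p q s"]
        by (auto simp: lookup_bd 2 simp del: of_nat_Suc split: if_splits)
    qed
    show "lk x k = 0"
      using k 1 2 5 6 unfolding monomials_eq by (cases k) auto
  next
    \<comment> \<open>Up to the factor \<open>r + 1\<close>, a chain with boundary \<open>Z3 V U1 ^ p U2 ^ q U3 ^ r\<close>, free of
      monomials from \<open>J\<close>. It corrects all monomials whose boundary is a multiple of such a term.\<close>
    define c' where "c' p q r = (real r + 1) *\<^sub>R unit (Mon True True False True p q r) +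
        (if r = 0 then 0 else unit (Mon False True False False p (Suc q) (Suc r))
          - unit (Mon True False False False (Suc p) q (Suc r)))" for p q r
    define c where "c p q r = (1 / (real r + 1)) *\<^sub>R c' p q r" for p q r
    have "bd (c' p q r) = (real r + 1) *\<^sub>R unit (Mon False False True True p q r)" for p q r
      by (cases r)
        (simp_all add: c'_def bd_unit bd_linear algebra_simps scaleR_numeral_expand)
    then have bd_c: "bd (c p q r) = unit (Mon False False True True p q r)" for p q r
      by (simp add: c_def bd_linear)
    have c_weight: "c p q r \<in> weight_space (w + 1) w" if "p + q + r + 2 = w" for p q r
      using that by (auto simp: c_def c'_def intro!: weight_space_closed unit_in_weight_space)
    have c_J: "lk (c p q r) i = 0" if "i \<in> ?J" for p q r i
      using that by (auto simp: c_def c'_def lookup_add lookup_minus lookup_scaleR lookup_single when_def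
          block_def low1_def slice_def)
    fix j assume j: "j \<in> ?J"
    then consider p q r where "j = Mon False False True False p q r" "p + q + r = w"
      | p q r where "j = Mon True False True True p q r" "p + q + r + 2 = w"
      | p q r where "j = Mon False True True True p q r" "p + q + r + 2 = w"
      | p q where "j = Mon True False False False p q 0" "p + q = w"
      | p q where "j = Mon True False False False (Suc p) q 1" "p + q + 2 = w"
      | p q where "j = Mon False True False False p q 0" "p + q = w"
      by (auto simp: block_def tri_def tri2_def low1_def slice_def gr0_conv_Suc)
    then show "\<exists>x. x \<in> weight_space (w + 1) w \<and> bd x = 0 \<and> (\<forall>i\<in>?J. lk x i = (if i = j then 1 else 0))"
    proof cases
      case (1 p q r)
      show ?thesis
      proof (rule nat_cases_upto_1[of r])
        fix s assume r: "r = Suc (Suc s)"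
        with 1 have "c p q s \<in> weight_space (w + 1) w" by (intro c_weight) simp
        with 1 r show ?thesis
          by (intro exI[of _ "unit j + (real r * (real r - 1)) *\<^sub>R c p q s"])
            (auto simp: bd_unit bd_linear bd_c lookup_add lookup_scaleR c_J lookup_single when_def
              intro!: weight_space_closed unit_in_weight_space c_weight)
      qed (use 1 in \<open>intro exI[of _ "unit j"], auto simp: bd_unit lookup_single when_def
          intro!: unit_in_weight_space\<close>)+
    next
      case (2 p q r)
      have "c p (Suc q) (r - 1) \<in> weight_space (w + 1) w" if "r > 0"
        using 2 that by (intro c_weight) simp
      with 2 show ?thesis
        by (intro exI[of _ "unit j - real r *\<^sub>R c p (Suc q) (r - 1)"]; cases r)
          (auto simp: bd_unit bd_linear bd_c lookup_minus lookup_scaleR c_J lookup_single when_def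
            intro!: weight_space_closed unit_in_weight_space c_weight)
    next
      case (3 p q r)
      have "c (Suc p) q (r - 1) \<in> weight_space (w + 1) w" if "r > 0"
        using 3 that by (intro c_weight) simp
      with 3 show ?thesis
        by (intro exI[of _ "unit j - real r *\<^sub>R c (Suc p) q (r - 1)"]; cases r)
          (auto simp: bd_unit bd_linear bd_c lookup_minus lookup_scaleR c_J lookup_single when_def
            intro!: weight_space_closed unit_in_weight_space c_weight)
    next
      case (5 p q)
      then show ?thesis
        by (intro exI[of _ "unit j - unit (Mon False True False False p (Suc q) 1)"])
          (auto simp: bd_unit bd_linear lookup_minus lookup_single when_def block_def slice_def
            intro!: weight_space_closed unit_in_weight_space)
    qed (intro exI[of _ "unit j"], auto simp: bd_unit lookup_single when_def intro!: unit_in_weight_space)+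
  qed
  then show ?thesis by (simp add: card_blocks card_tri card_tri2 card_low1 card_slice assms)
qed

text \<open>The only condition is the vanishing of the coefficients of \<open>V\<close> in the boundary. It determines
  the coefficients of the pure \<open>U\<close>-monomials with at least two factors \<open>U3\<close>.\<close>

lemma dim_cycle_space_0:
  assumes "w > 0"
  shows "dim (cycle_space w w) = 3 * (w choose 2) + (2 * w + 1)"
proof -
  let ?J = "block True False False True (tri2 w) \<union> block False True False True (tri2 w)
    \<union> block False False True True (tri2 w) \<union> block False False False False (low w)"
  have "dim (cycle_space w w) = card ?J"
  proof (rule dim_cycle_space_eq_card)
    show "?J \<subseteq> monomials w w"
      by (auto simp: block_def monomials_def tri2_def low_def)
  next
    fix x k assume x: "x \<in> cycle_space w w" and J: "\<And>j. j \<in> ?J \<Longrightarrow> lk x j = 0"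
      and k: "k \<in> monomials w w"
    note eq = lookup_bd_cycle[OF x]
    have out: "lk x (Mon a1 a2 a3 e p q r) = 0"
      if "\<not> (of_bool a1 + of_bool a2 + of_bool a3 = of_bool e + (0::nat) \<and> p + q + r + 2 * of_bool e = w)"
      for a1 a2 a3 e p q r
      using lookup_cycle_outside[OF x] that by (auto simp: monomials_def)
    have 1: "lk x (Mon True False False True p q r) = 0"
      "lk x (Mon False True False True p q r) = 0"
      "lk x (Mon False False True True p q r) = 0" for p q r
      using J[of "Mon True False False True p q r"] out[of True False False True p q r]
        J[of "Mon False True False True p q r"] out[of False True False True p q r]
        J[of "Mon False False True True p q r"] out[of False False True True p q r]
      by (auto simp: tri2_def)
    have 2: "lk x (Mon False False False False p q r) = 0" for p q r
    proof (cases "r \<le> 1")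
      case True
      then show ?thesis
        using J[of "Mon False False False False p q r"] out[of False False False False p q r]
        by (auto simp: low_def)
    next
      case False
      then obtain s where "r = Suc (Suc s)" by (cases r rule: nat_cases_upto_1) auto
      then show ?thesis using eq[of "Mon False False False True p q s"]
        by (auto simp: lookup_bd 1 simp del: of_nat_Suc split: if_splits)
    qed
    show "lk x k = 0"
      using k 1 2 unfolding monomials_eq by (cases k) auto
  next
    fix j assume j: "j \<in> ?J"
    then consider p q r where "j = Mon True False False True p q r" "p + q + r + 2 = w"
      | p q r where "j = Mon False True False True p q r" "p + q + r + 2 = w"
      | p q r where "j = Mon False False True True p q r" "p + q + r + 2 = w"
      | p q r where "j = Mon False False False False p q r" "p + q + r = w" "r \<le> 1"
      by (auto simp: block_def tri2_def low_def)
    then show "\<exists>x. x \<in> weight_space w w \<and> bd x = 0 \<and> (\<forall>i\<in>?J. lk x i = (if i = j then 1 else 0))"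
    proof cases
      case (1 p q r)
      then show ?thesis
        by (intro exI[of _ "unit j - (if r = 0 then 0 else (1 / (real r + 1)) *\<^sub>R
              unit (Mon False False False False p (Suc q) (Suc r)))"]; cases r)
          (auto simp: bd_unit bd_linear lookup_minus lookup_scaleR lookup_single when_def
              block_def low_def tri2_def intro!: weight_space_closed unit_in_weight_space)
    next
      case (2 p q r)
      then show ?thesis
        by (intro exI[of _ "unit j - (if r = 0 then 0 else (1 / (real r + 1)) *\<^sub>R
              unit (Mon False False False False (Suc p) q (Suc r)))"]; cases r)
          (auto simp: bd_unit bd_linear lookup_minus lookup_scaleR lookup_single when_def
              block_def low_def tri2_def intro!: weight_space_closed unit_in_weight_space)
    next
      case (4 p q r)
      then show ?thesis
        by (intro exI[of _ "unit j"]; cases r)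
          (auto simp: bd_unit lookup_single when_def intro!: unit_in_weight_space)
    qed (intro exI[of _ "unit j"], auto simp: bd_unit lookup_single when_def intro!: unit_in_weight_space)+
  qed
  then show ?thesis by (simp add: card_blocks card_tri2 card_low assms)
qed

text \<open>Without \<open>Z\<close>-factors and with \<open>V\<close> present, nothing can be contracted.\<close>

lemma dim_cycle_space_minus_1:
  assumes "w > 0"
  shows "dim (cycle_space (w - 1) w) = w choose 2"
proof -
  let ?J = "monomials (w - 1) w"
  have "dim (cycle_space (w - 1) w) = card ?J"
  proof (rule dim_cycle_space_eq_card)
    fix j assume "j \<in> ?J"
    then obtain p q r where "j = Mon False False False True p q r" "p + q + r + 2 = w"
      unfolding monomials_eq(1)[OF assms] by (auto simp: block_def tri2_def)
    then show "\<exists>x. x \<in> weight_space (w - 1) w \<and> bd x = 0 \<and> (\<forall>i\<in>?J. lk x i = (if i = j then 1 else 0))"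
      by (intro exI[of _ "unit j"])
        (auto simp: bd_unit lookup_single when_def
          intro!: unit_in_weight_space)
  qed auto
  then show ?thesis by (simp only: card_monomials(1)[OF assms])
qed

lemma dim_cycle_space_4: "dim (cycle_space (w + 4) w) = 0"
  using dim_weight_space_rank_nullity[of "w + 4" w] by (simp add: card_monomials)

section \<open>The Heisenberg algebra\<close>

text \<open>Since the derived algebra is not 0, some \<open>z = [a, b]\<close> is nonzero. As \<open>z\<close> is central, bracketing a
  linear relation between \<open>a\<close>, \<open>b\<close>, \<open>z\<close> with \<open>a\<close> or \<open>b\<close> shows that these are independent, hence a basis.\<close>

lemma heisenberg_basis_exists:
  fixes br :: "'a::real_vector \<Rightarrow> 'a \<Rightarrow> 'a"
  assumes lie: "lie_bracket br" and dim3: "dim (UNIV :: 'a set) = 3"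
    and der: "dim (derived_algebra br) = 1" and central: "derived_algebra br \<subseteq> lie_center br"
  obtains z1 z2 z3 c1 c2 c3 where "heisenberg br z1 z2 z3 c1 c2 c3"
proof -
  have bil: "bilinear br" and alt: "br x x = 0" for x
    using lie by (auto simp: lie_bracket_def)
  note br_simps = bilinear_ladd[OF bil] bilinear_radd[OF bil] bilinear_lmul[OF bil]
    bilinear_rmul[OF bil] alt
  have anti: "br y x = - br x y" for x y
  proof -
    have "br x y + br y x = br (x + y) (x + y)"
      by (simp only: bilinear_ladd[OF bil] bilinear_radd[OF bil]) (simp add: alt)
    also have "\<dots> = 0" by (rule alt)
    finally show ?thesis by (rule minus_unique[symmetric])
  qed
  have "\<exists>a b. br a b \<noteq> 0"
  proof (rule ccontr)
    assume "\<nexists>a b. br a b \<noteq> 0"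
    then have "derived_algebra br \<subseteq> span {}"
      unfolding derived_algebra_def by (intro span_minimal) auto
    then have "dim (derived_algebra br) \<le> card ({} :: 'a set)"
      by (rule dim_le_card) simp
    with der show False by simp
  qed
  then obtain a b where ab: "br a b \<noteq> 0" by blast
  define z where "z = br a b"
  have "z \<in> derived_algebra br"
    unfolding derived_algebra_def z_def by (rule span_base) blast
  then have z1: "br z x = 0" for x
    using central by (auto simp: lie_center_def)
  then have z2: "br x z = 0" for x by (simp add: anti[of x z])
  have "z \<noteq> 0" using ab by (simp add: z_def)
  have b: "b \<notin> span {z}"
  proof
    assume "b \<in> span {z}"
    then obtain k where "b = k *\<^sub>R z" by (auto simp: span_singleton)
    then have "z = k *\<^sub>R br a z" unfolding z_def by (metis bilinear_rmul[OF bil])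
    with z2 \<open>z \<noteq> 0\<close> show False by simp
  qed
  have a: "a \<notin> span {b, z}"
  proof
    assume "a \<in> span {b, z}"
    then obtain k where "a - k *\<^sub>R b \<in> span {z}" by (auto simp: span_insert)
    then obtain l where "a - k *\<^sub>R b = l *\<^sub>R z" by (auto simp: span_singleton)
    then have "a = k *\<^sub>R b + l *\<^sub>R z" by (simp add: algebra_simps)
    then have "br a b = br (k *\<^sub>R b + l *\<^sub>R z) b" by simp
    then have "br a b = 0" by (simp add: br_simps z1)
    with ab show False by simp
  qed
  have ind: "independent {a, b, z}"
    using a b \<open>z \<noteq> 0\<close> by (intro independent_insertI independent_empty) auto
  have ne: "a \<noteq> b" "a \<noteq> z" "b \<noteq> z"
    using a b by (auto intro: span_base)
  obtain C where C: "{a, b, z} \<subseteq> C" "C \<subseteq> UNIV" "independent C" "UNIV \<subseteq> span C"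
    using maximal_independent_subset_extend[OF subset_UNIV ind] by blast
  have "card C = 3" using basis_card_eq_dim[OF C(2,4,3)] dim3 by simp
  moreover have "card {a, b, z} = 3" using ne by simp
  ultimately have "{a, b, z} = C"
    using C(1) by (intro card_subset_eq) (auto intro: card_ge_0_finite)
  then have sp: "span {a, b, z} = UNIV" using C(4) by blast
  have coord: "\<exists>c. linear c \<and> c a = x \<and> c b = y \<and> c z = t" for x y t :: real
  proof -
    obtain c where "linear c"
      "\<And>v. v \<in> {a, b, z} \<Longrightarrow> c v = (if v = a then x else if v = b then y else t)"
      using linear_independent_extend[OF ind, of "\<lambda>v. if v = a then x else if v = b then y else t"]
      by blast
    then show ?thesis using ne by (intro exI[of _ c]) auto
  qed
  obtain c1 where c1: "linear c1" "c1 a = 1" "c1 b = 0" "c1 z = (0::real)" using coord by blast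
  obtain c2 where c2: "linear c2" "c2 a = 0" "c2 b = 1" "c2 z = (0::real)" using coord by blast
  obtain c3 where c3: "linear c3" "c3 a = 0" "c3 b = 0" "c3 z = (1::real)" using coord by blast
  have expand: "x = c1 x *\<^sub>R a + c2 x *\<^sub>R b + c3 x *\<^sub>R z" for x
  proof (rule linear_eq_on[of "\<lambda>x. x" "\<lambda>x. c1 x *\<^sub>R a + c2 x *\<^sub>R b + c3 x *\<^sub>R z" x "{a, b, z}"])
    show "linear (\<lambda>x. c1 x *\<^sub>R a + c2 x *\<^sub>R b + c3 x *\<^sub>R z)"
      by (rule linearI) (simp_all add: linear_add linear_scale c1(1) c2(1) c3(1) algebra_simps)
  qed (use sp c1 c2 c3 in \<open>auto intro!: linearI\<close>)
  have "br x y = (c1 x * c2 y - c2 x * c1 y) *\<^sub>R z" for x y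
    by (subst expand[of x], subst expand[of y])
      (simp add: br_simps z1 z2 anti[of b a] z_def[symmetric] algebra_simps)
  then have "heisenberg br a b z c1 c2 c3"
    by (intro heisenberg.intro c1 c2 c3 expand)
  then show thesis by (rule that)
qed

theorem theorem6p1:
  fixes br :: "'a::real_vector \<Rightarrow> 'a \<Rightarrow> 'a" and w :: nat
  assumes "lie_bracket br"
    and "dim (UNIV :: 'a set) = 3"
    and "dim (derived_algebra br) = 1"
    and "derived_algebra br \<subseteq> lie_center br"
    and "w > 0"
  shows
    "int (dim (weight_chains (w - 1) w :: 'a chain set)) = int (w choose 2) \<and>
     int (dim (weight_cycles br (w - 1) w)) = int (w choose 2) \<and>
     int (betti br (w - 1) w) = 0 \<and>

     int (dim (weight_chains w w :: 'a chain set)) = 3 * int (w choose 2) + int ((w + 2) choose 2) \<and>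
     int (dim (weight_cycles br w w)) = 2 * int (w choose 2) + int ((w + 2) choose 2) \<and>
     int (betti br w w) = int w \<and>

     int (dim (weight_chains (w + 1) w :: 'a chain set)) = 3 * int (w choose 2) + 3 * int ((w + 2) choose 2) \<and>
     int (dim (weight_cycles br (w + 1) w)) = int (w choose 2) + 2 * int ((w + 2) choose 2) + int w \<and>
     int (betti br (w + 1) w) = 3 * int w + 1 \<and>

     int (dim (weight_chains (w + 2) w :: 'a chain set)) = int (w choose 2) + 3 * int ((w + 2) choose 2) \<and>
     int (dim (weight_cycles br (w + 2) w)) = - int (w choose 2) + 2 * int ((w + 2) choose 2) \<and>
     int (betti br (w + 2) w) = 3 * int w + 2 \<and>

     int (dim (weight_chains (w + 3) w :: 'a chain set)) = int ((w + 2) choose 2) \<and>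
     int (dim (weight_cycles br (w + 3) w)) = int w + 1 \<and>
     int (betti br (w + 3) w) = int w + 1"
proof -
  obtain z1 z2 z3 c1 c2 c3 where "heisenberg br z1 z2 z3 c1 c2 c3"
    by (rule heisenberg_basis_exists[OF assms(1-4)])
  then interpret heisenberg br z1 z2 z3 c1 c2 c3 .
  have choose: "(w + 2) choose 2 = (w choose 2) + 2 * w + 1"
    by (simp add: numeral_2_eq_2)
  note dims = dim_weight_chains dim_weight_cycles
    card_monomials(1)[OF assms(5)] card_monomials(2-6)
    dim_cycle_space_minus_1[OF assms(5)] dim_cycle_space_0[OF assms(5)] dim_cycle_space_1[OF assms(5)] dim_cycle_space_2[OF assms(5)]
    dim_cycle_space_3 dim_cycle_space_4
  have homology:
    "int (betti br (w - 1) w) = int (dim (cycle_space (w - 1) w)) + int (dim (cycle_space w w)) - int (card (monomials w w))"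
    "int (betti br w w) = int (dim (cycle_space w w)) + int (dim (cycle_space (w + 1) w)) - int (card (monomials (w + 1) w))"
    "int (betti br (w + 1) w) =
       int (dim (cycle_space (w + 1) w)) + int (dim (cycle_space (w + 2) w)) - int (card (monomials (w + 2) w))"
    "int (betti br (w + 2) w) =
       int (dim (cycle_space (w + 2) w)) + int (dim (cycle_space (w + 3) w)) - int (card (monomials (w + 3) w))"
    "int (betti br (w + 3) w) =
       int (dim (cycle_space (w + 3) w)) + int (dim (cycle_space (w + 4) w)) - int (card (monomials (w + 4) w))"
    using betti_eq[of "w - 1" w] betti_eq[of w w] betti_eq[of "w + 1" w] betti_eq[of "w + 2" w]
      betti_eq[of "w + 3" w] assms(5)
    by (simp_all add: eval_nat_numeral)
  show ?thesis
    unfolding homology dims choose by simp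
qed

end
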